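(* Let $n\geq 2$ and write any $A\in\mathbb{C}^{n\times n}$ as $A=[a_{j,k}]$. Define \[ \widetilde{\Omega}_{1,n}:=\{A\in\Omega_{1,n} : \widehat{A}\text{ is non-derogatory and } (a_{2,1},\dots,a_{n,1})^T \text{ is a cyclic vector of } \widehat{A}\}. \] Then: (1) The set $\mathfrak{S}_{1,n}:=\Omega_{1,n}\setminus\widetilde{\Omega}_{1,n}$ has zero Lebesgue measure in $\mathbb{C}^{n\times n}\cong\mathbb{R}^{2n^2}$. (2) The map $\pi_n$ is holomorphic and maps $\Omega_{1,n}$ onto $\mathbb{G}_{1,n}$. (3) Let $\zeta_1,\dots,\zeta_M$ be distinct points of $\mathbb{D}$ and let $W_1,\dots,W_M\in\widetilde{\Omega}_{1,n}$. Then there exists a holomorphic map $F:\mathbb{D}\to\Omega_{1,n}$ with $F(\zeta_j)=W_j$ for all $j\le M$ if and only if there exists a holomorphic map $f:\mathbb{D}\to\mathbb{G}_{1,n}$ with $f(\zeta_j)=\pi_n(W_j)$ for all $j\le M$.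
   Context: $\mathbb{D}$ is the open unit disc in $\mathbb{C}$. For $A\in\mathbb{C}^{n\times n}$, $\widehat{A}$ denotes the $(n-1)\times(n-1)$ matrix obtained by deleting the first row and first column of $A$. For $1\le j\le n$, $\mathscr{I}^j$ is the set of increasing $j$-tuples $I=(i_1<\dots<i_j)$ in $\{1,\dots,n\}^j$, and $A_I$ is the $j\times j$ submatrix of $A$ with rows and columns indexed by $I$. A square matrix $X\in\mathbb{C}^{k\times k}$ is non-derogatory if it has a cyclic vector, i.e. a $v$ with $v,Xv,\dots,X^{k-1}v$ spanning $\mathbb{C}^k$. Structured singular value: for a linear subspace $E\subseteq\mathbb{C}^{n\times n}$, $\mu_E(A):=\big(\inf\{\|X\|: X\in E,\ \mathbb{I}-AX \text{ singular}\}\big)^{-1}$, where $\|\cdot\|$ is the operator norm for the Euclidean norm. Let $E^{1,n}:=\{[w]\oplus(z\mathbb{I}_{n-1}): z,w\in\mathbb{C}\}$ and $\Omega_{1,n}:=\{A\in\mathbb{C}^{n\times n}:\mu_{E^{1,n}}(A)<1\}$. For $(x,y)\in\mathbb{C}^n\times\mathbb{C}^{n-1}$ let $P_n(z;x):=\sum_{j=0}^{n-1}(-1)^jx_{j+1}z^j$ and $Q_n(z;y):=1+\sum_{j=1}^{n-1}(-1)^jy_jz^j$. The $\mu_{1,n}$-quotient is $\mathbb{G}_{1,n}:=\{(x,y)\in\mathbb{C}^n\times\mathbb{C}^{n-1}: \text{the zero set in }\mathbb{C}^2\text{ of }(z,w)\mapsto Q_n(z;y)-wP_n(z;x)\text{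 does not meet }\overline{\mathbb{D}}^2\}$. The map $\pi_n:\mathbb{C}^{n\times n}\to\mathbb{C}^n\times\mathbb{C}^{n-1}$ is $\pi_n(A)=(X(A),Y(A))$ with $X_1(A)=a_{1,1}$, $X_j(A)=\sum_{I\in\mathscr{I}^j: i_1=1}\det(A_I)$ for $2\le j\le n$, and $Y_j(A)=\sum_{I\in\mathscr{I}^j: i_1\ge2}\det(A_I)$ for $1\le j\le n-1$. *)

theory Defs
  imports "HOL-Analysis.Analysis" "HOL-Library.Extended_Real"
begin

text \<open>Conventions. An n x n complex matrix is a function A :: nat => nat => complex
  whose entries are indexed 0..n-1 (so the paper's a_{j,k} is A (j-1) (k-1)) and
  which vanishes outside {0..<n} x {0..<n}.\<close>

type_synonym cmat = "nat \<Rightarrow> nat \<Rightarrow> complex"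
type_synonym cvec = "nat \<Rightarrow> complex"

definition mats :: "nat \<Rightarrow> cmat set" where
  "mats n = {A. \<forall>i j. (n \<le> i \<or> n \<le> j) \<longrightarrow> A i j = 0}"

definition detn :: "nat \<Rightarrow> cmat \<Rightarrow> complex" where
  "detn k M = (\<Sum>p | p permutes {..<k}. of_int (sign p) * (\<Prod>i<k. M i (p i)))"

definition idm :: "nat \<Rightarrow> cmat" where
  "idm n = (\<lambda>i j. if i < n \<and> j < n \<and> i = j then 1 else 0)"

definition mmult :: "nat \<Rightarrow> cmat \<Rightarrow> cmat \<Rightarrow> cmat" where
  "mmult n A B = (\<lambda>i j. \<Sum>k<n. A i k * B k j)"

definition mvec :: "nat \<Rightarrow> cmat \<Rightarrow> cvec \<Rightarrow> cvec" where
  "mvec n A v = (\<lambda>i. \<Sum>k<n. A i k * v k)"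

definition singular :: "nat \<Rightarrow> cmat \<Rightarrow> bool" where
  "singular n M \<longleftrightarrow> detn n M = 0"

definition vnorm :: "nat \<Rightarrow> cvec \<Rightarrow> real" where
  "vnorm n v = sqrt (\<Sum>i<n. (cmod (v i))\<^sup>2)"

definition opnorm :: "nat \<Rightarrow> cmat \<Rightarrow> real" where
  "opnorm n X = Sup {vnorm n (mvec n X v) | v. vnorm n v \<le> 1}"

text \<open>Structured singular value, with inf of the empty set = +infinity and
  inverse +infinity = 0 (extended reals).\<close>
definition mu :: "nat \<Rightarrow> cmat set \<Rightarrow> cmat \<Rightarrow> ereal" where
  "mu n E A = inverse (Inf ((\<lambda>X. ereal (opnorm n X)) `
       {X \<in> E. singular n (\<lambda>i j. idm n i j - mmult n A X i j)}))"

definition E1n :: "nat \<Rightarrow> cmat set" where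
  "E1n n = {X. \<exists>z w. X = (\<lambda>i j. if i < n \<and> j < n \<and> i = j then (if i = 0 then w else z) else 0)}"

definition Omega :: "nat \<Rightarrow> cmat set" where
  "Omega n = {A \<in> mats n. mu n (E1n n) A < 1}"

definition cyclic_vec :: "nat \<Rightarrow> cmat \<Rightarrow> cvec \<Rightarrow> bool" where
  "cyclic_vec k X v \<longleftrightarrow>
     (\<forall>w::cvec. \<exists>c::nat \<Rightarrow> complex. \<forall>i<k. w i = (\<Sum>m<k. c m * ((mvec k X ^^ m) v) i))"

definition non_derogatory :: "nat \<Rightarrow> cmat \<Rightarrow> bool" where
  "non_derogatory k X \<longleftrightarrow> (\<exists>v. cyclic_vec k X v)"

definition hatm :: "cmat \<Rightarrow> cmat" where
  "hatm A = (\<lambda>i j. A (Suc i) (Suc j))"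

definition firstcol :: "nat \<Rightarrow> cmat \<Rightarrow> cvec" where
  "firstcol n A = (\<lambda>i. if i < n - 1 then A (Suc i) 0 else 0)"

definition Omega_t :: "nat \<Rightarrow> cmat set" where
  "Omega_t n = {A \<in> Omega n. non_derogatory (n - 1) (hatm A)
                 \<and> cyclic_vec (n - 1) (hatm A) (firstcol n A)}"

definition minor :: "cmat \<Rightarrow> nat set \<Rightarrow> complex" where
  "minor A I = (let s = sorted_list_of_set I in detn (card I) (\<lambda>a b. A (s ! a) (s ! b)))"

text \<open>pi_n A = (X(A), Y(A)); x = (x_1..x_n), y = (y_1..y_{n-1}) are stored 1-based,
  as functions nat => complex vanishing outside their index range.\<close>
definition Xc :: "nat \<Rightarrow> cmat \<Rightarrow> cvec" where
  "Xc n A = (\<lambda>j. if j = 1 then A 0 0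
               else if 2 \<le> j \<and> j \<le> n then (\<Sum>I | I \<subseteq> {..<n} \<and> card I = j \<and> 0 \<in> I. minor A I)
               else 0)"

definition Yc :: "nat \<Rightarrow> cmat \<Rightarrow> cvec" where
  "Yc n A = (\<lambda>j. if 1 \<le> j \<and> j \<le> n - 1 then (\<Sum>I | I \<subseteq> {..<n} \<and> card I = j \<and> 0 \<notin> I. minor A I)
               else 0)"

definition pin :: "nat \<Rightarrow> cmat \<Rightarrow> cvec \<times> cvec" where
  "pin n A = (Xc n A, Yc n A)"

definition Pn :: "nat \<Rightarrow> complex \<Rightarrow> cvec \<Rightarrow> complex" where
  "Pn n z x = (\<Sum>j<n. (-1) ^ j * x (Suc j) * z ^ j)"

definition Qn :: "nat \<Rightarrow> complex \<Rightarrow> cvec \<Rightarrow> complex" where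
  "Qn n z y = 1 + (\<Sum>j\<in>{1..n-1}. (-1) ^ j * y j * z ^ j)"

definition G1n :: "nat \<Rightarrow> (cvec \<times> cvec) set" where
  "G1n n = {(x, y). (\<forall>j. (j < 1 \<or> n < j) \<longrightarrow> x j = 0) \<and> (\<forall>j. (j < 1 \<or> n - 1 < j) \<longrightarrow> y j = 0)
      \<and> (\<forall>z w. cmod z \<le> 1 \<and> cmod w \<le> 1 \<longrightarrow> Qn n z y - w * Pn n z x \<noteq> 0)}"

definition holo_into_mats :: "nat \<Rightarrow> (complex \<Rightarrow> cmat) \<Rightarrow> cmat set \<Rightarrow> bool" where
  "holo_into_mats n F S \<longleftrightarrow> (\<forall>z \<in> ball 0 1. F z \<in> S)
      \<and> (\<forall>i<n. \<forall>j<n. (\<lambda>z. F z i j) holomorphic_on ball 0 1)"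

definition holo_into_pairs :: "(complex \<Rightarrow> cvec \<times> cvec) \<Rightarrow> (cvec \<times> cvec) set \<Rightarrow> bool" where
  "holo_into_pairs f S \<longleftrightarrow> (\<forall>z \<in> ball 0 1. f z \<in> S)
      \<and> (\<forall>j. (\<lambda>z. fst (f z) j) holomorphic_on ball 0 1 \<and> (\<lambda>z. snd (f z) j) holomorphic_on ball 0 1)"

text \<open>Holomorphic function of the n^2 entries of a matrix (on all of C^{n x n}):
  continuous and holomorphic in each entry separately (Osgood).\<close>
definition holo_mat_fun :: "nat \<Rightarrow> (cmat \<Rightarrow> complex) \<Rightarrow> bool" where
  "holo_mat_fun n g \<longleftrightarrow> continuous_on (mats n) g
      \<and> (\<forall>A \<in> mats n. \<forall>i<n. \<forall>j<n. (\<lambda>t. g (A(i := (A i)(j := t)))) holomorphic_on UNIV)"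

definition lebesgue_null_mats :: "nat \<Rightarrow> cmat set \<Rightarrow> bool" where
  "lebesgue_null_mats n S \<longleftrightarrow>
     (\<lambda>A. restrict (\<lambda>(i, j). A i j) ({..<n} \<times> {..<n})) ` S
       \<in> null_sets (completion (PiM ({..<n} \<times> {..<n}) (\<lambda>_. (lborel :: complex measure))))"

end

theory Submission
  imports Defs "HOL-Complex_Analysis.Complex_Analysis" "Jordan_Normal_Form.Determinant"
begin

text \<open>For \<open>D = [w] \<oplus> z I\<close> the determinant of \<open>I - A D\<close> is \<open>Q_n(z; Y(A)) - w P_n(z; X(A))\<close>, so
  \<open>A\<close> belongs to \<open>\<Omega>\<close> iff \<open>\<pi>(A)\<close> belongs to the quotient, and \<open>\<pi>\<close> is invariant under conjugation by
  \<open>[1] \<oplus> S\<close>. Every point \<open>(x, y)\<close> is the image of a companion-like matrix \<open>canon n x y\<close> whose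
  entries are polynomials in \<open>(x, y)\<close>, and a matrix \<open>A\<close> whose first column is cyclic is conjugate by
  some \<open>[1] \<oplus> S\<close> to \<open>canon n (\<pi>(A))\<close>. Interpolating the matrices \<open>S\<close> by a holomorphic map into the
  general linear group, which is generated by rank one perturbations of the identity, lifts \<open>f\<close> to
  \<open>F\<close>. The exceptional matrices lie in the zero set of the Krylov determinant, a nonzero polynomial
  in the entries; Fubini's theorem shows that such a zero set is null.\<close>

subsection \<open>Determinants and the structured pencil\<close>

text \<open>Everything about \<open>pin\<close> is read off the determinant of the pencil: as a
  polynomial in z and w it determines every coordinate of \<open>pin\<close>. Invariance under
  conjugation and the value at \<open>canon\<close> thus become determinant computations, and no
  minor of a product is ever expanded. The delicate point of the lifting is invertibility.
  Interpolating the conjugating matrices entry by entry with polynomials is easy, but the result may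
  become singular away from the nodes, where conjugation then breaks down. Hence the conjugators are
  interpolated one node at a time, by factors equal to the identity at all other nodes, and each
  factor is split into rank one updates whose determinant is a controlled scalar. Cyclicity enters
  at the nodes only: it makes each prescribed matrix conjugate to the canonical matrix with the same
  \<open>pin\<close>. At all other points the lift is a conjugate of a canonical matrix by
  construction.\<close>

lemma detn_eq_det: "detn n A = Determinant.det (Matrix.mat n n (\<lambda>(i, j). A i j))"
proof -
  have "(\<Prod>i<n. A i (p i)) = (\<Prod>i = 0..<n. Matrix.mat n n (\<lambda>(i, j). A i j) $$ (i, p i))"
    if "p permutes {..<n}" for p
  proof (rule prod.cong)
    fix i assume "i \<in> {0..<n}"
    moreover from this have "p i < n"
      using permutes_in_image[OF that, of i] by simp
    ultimately show "A i (p i) = Matrix.mat n n (\<lambda>(i, j). A i j) $$ (i, p i)" by simp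
  qed auto
  then show ?thesis
    by (simp add: detn_def Determinant.det_def atLeast0LessThan)
qed

lemma detn_cong:
  assumes "\<And>i j. i < n \<Longrightarrow> j < n \<Longrightarrow> A i j = B i j"
  shows "detn n A = detn n B"
  unfolding detn_eq_det using assms by (intro arg_cong[of _ _ Determinant.det]) auto

lemma mat_mmult:
  "Matrix.mat n n (\<lambda>(i, j). mmult n A B i j) =
     Matrix.mat n n (\<lambda>(i, j). A i j) * Matrix.mat n n (\<lambda>(i, j). B i j)"
  by (rule eq_matI) (auto simp: mmult_def scalar_prod_def lessThan_atLeast0)

lemma mat_idm: "Matrix.mat n n (\<lambda>(i, j). idm n i j) = 1\<^sub>m n"
  by (rule eq_matI) (auto simp: idm_def)

lemma detn_mmult: "detn n (mmult n A B) = detn n A * detn n B"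
  unfolding detn_eq_det mat_mmult by (rule det_mult) auto

lemma detn_idm: "detn n (idm n) = 1"
  by (simp add: detn_eq_det mat_idm)

definition struct_diag :: "nat \<Rightarrow> complex \<Rightarrow> complex \<Rightarrow> cmat" where
  "struct_diag n w z = (\<lambda>i j. if i < n \<and> j < n \<and> i = j then (if i = 0 then w else z) else 0)"

lemma E1n_eq: "E1n n = {struct_diag n w z | w z. True}"
  by (auto simp: E1n_def struct_diag_def)

lemma mmult_struct_diag:
  "mmult n A (struct_diag n w z) = (\<lambda>i j. if j < n then A i j * (if j = 0 then w else z) else 0)"
proof (intro ext)
  fix i j
  have "(\<Sum>k<n. A i k * struct_diag n w z k j) = (\<Sum>k<n. if k = j then A i j * (if j = 0 then w else z) else 0)"
    by (rule sum.cong) (auto simp: struct_diag_def)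
  then show "mmult n A (struct_diag n w z) i j = (if j < n then A i j * (if j = 0 then w else z) else 0)"
    by (simp add: mmult_def)
qed

definition pencil :: "nat \<Rightarrow> cmat \<Rightarrow> complex \<Rightarrow> complex \<Rightarrow> cmat" where
  "pencil n A w z = (\<lambda>i j. idm n i j - mmult n A (struct_diag n w z) i j)"

text \<open>Transporting permutations along the enumeration of \<open>I\<close> keeps their sign.
  This form has no ordering left in it, which suits sums over subsets.\<close>

lemma minor_eq_permutes:
  assumes "finite I"
  shows "minor A I = (\<Sum>p | p permutes I. of_int (sign p) * (\<Prod>i\<in>I. A i (p i)))"
proof -
  define s where "s = (!) (sorted_list_of_set I)"
  have bij: "bij_betw s {..<card I} I"
    unfolding s_def using bij_betw_nth[of "sorted_list_of_set I" "{..<card I}" I] assms by simp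
  then have inj: "inj_on s {..<card I}" by (simp add: bij_betw_def)
  let ?f = "map_permutation {..<card I} s"
  have "minor A I = (\<Sum>p | p permutes {..<card I}. of_int (sign p) * (\<Prod>i<card I. A (s i) (s (p i))))"
    by (simp add: minor_def detn_def Let_def s_def)
  also have "\<dots> = (\<Sum>p | p permutes I. of_int (sign p) * (\<Prod>i\<in>I. A i (p i)))"
  proof (rule sum.reindex_bij_witness[where i = "map_permutation I (inv_into {..<card I} s)" and j = ?f])
    fix p assume "p \<in> {p. p permutes {..<card I}}"
    then have p: "p permutes {..<card I}" by simp
    show "map_permutation I (inv_into {..<card I} s) (?f p) = p"
      by (rule map_permutation_compose_inv[OF bij p]) (use inj in simp)
    show "?f p \<in> {p. p permutes I}"
      using map_permutation_permutes[OF bij p] by simp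
    have "(\<Prod>i\<in>I. A i (?f p i)) = (\<Prod>i<card I. A (s i) (?f p (s i)))"
      using prod.reindex_bij_betw[OF bij, of "\<lambda>i. A i (?f p i)"] by simp
    also have "\<dots> = (\<Prod>i<card I. A (s i) (s (p i)))"
      using map_permutation_apply[OF inj] by (intro prod.cong) auto
    finally show "of_int (sign (?f p)) * (\<Prod>i\<in>I. A i (?f p i))
        = of_int (sign p) * (\<Prod>i<card I. A (s i) (s (p i)))"
      using sign_map_permutation[OF inj p] by simp
  next
    fix p assume "p \<in> {p. p permutes I}"
    then have p: "p permutes I" by simp
    have bij': "bij_betw (inv_into {..<card I} s) I {..<card I}"
      using bij by (rule bij_betw_inv_into)
    show "?f (map_permutation I (inv_into {..<card I} s) p) = p"
      by (rule map_permutation_compose_inv[OF bij' p])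
        (use bij in \<open>simp add: bij_betw_inv_into_right\<close>)
    show "map_permutation I (inv_into {..<card I} s) p \<in> {p. p permutes {..<card I}}"
      using map_permutation_permutes[OF bij' p] by simp
  qed
  finally show ?thesis .
qed

text \<open>In each Leibniz product let \<open>I\<close> be the set of rows that contribute the
  entry of \<open>A\<close>. The identity entries of the other rows survive only if the permutation
  fixes those rows, that is, if it permutes \<open>I\<close>; what remains is the Leibniz sum of a
  principal minor.\<close>

lemma detn_id_minus_scaled:
  fixes d :: "nat \<Rightarrow> complex"
  shows "detn n (\<lambda>i j. idm n i j - A i j * d j) =
    (\<Sum>I\<in>Pow {..<n}. (\<Prod>i\<in>I. - d i) * minor A I)"
proof -
  let ?t = "\<lambda>p I. (\<Prod>i\<in>I. - (A i (p i) * d (p i))) * (\<Prod>i\<in>{..<n} - I. if p i = i then 1 else 0)"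
  have "detn n (\<lambda>i j. idm n i j - A i j * d j) =
     (\<Sum>p | p permutes {..<n}. of_int (sign p) * (\<Sum>I\<in>Pow {..<n}. ?t p I))"
    unfolding detn_def
  proof (intro sum.cong refl arg_cong2[of _ _ _ _ "(*)"])
    fix p assume "p \<in> {p. p permutes {..<n}}"
    then have p: "p i < n" if "i < n" for i
      using permutes_in_image[of p "{..<n}" i] that by simp
    have "(\<Prod>i<n. idm n i (p i) - A i (p i) * d (p i)) =
        (\<Prod>i<n. - (A i (p i) * d (p i)) + (if p i = i then 1 else 0))"
      by (rule prod.cong) (auto simp: idm_def p)
    then show "(\<Prod>i<n. idm n i (p i) - A i (p i) * d (p i)) = (\<Sum>I\<in>Pow {..<n}. ?t p I)"
      by (subst (asm) prod_add) auto
  qed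
  also have "\<dots> = (\<Sum>I\<in>Pow {..<n}. \<Sum>p | p permutes {..<n}. of_int (sign p) * ?t p I)"
    unfolding sum_distrib_left by (rule sum.swap)
  also have "\<dots> = (\<Sum>I\<in>Pow {..<n}. (\<Prod>i\<in>I. - d i) * minor A I)"
  proof (rule sum.cong[OF refl])
    fix I assume "I \<in> Pow {..<n}"
    then have I: "I \<subseteq> {..<n}" "finite I" by (auto intro: finite_subset)
    have "(\<Sum>p | p permutes {..<n}. of_int (sign p) * ?t p I) =
      (\<Sum>p | p permutes I. (\<Prod>i\<in>I. - d i) * (of_int (sign p) * (\<Prod>i\<in>I. A i (p i))))"
    proof (rule sum.mono_neutral_cong_right)
      show "finite {p. p permutes {..<n}}" by (simp add: finite_permutations)
      show "{p. p permutes I} \<subseteq> {p. p permutes {..<n}}"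
        using I by (auto intro: permutes_subset)
      show "\<forall>p\<in>{p. p permutes {..<n}} - {p. p permutes I}. of_int (sign p) * ?t p I = 0"
      proof
        fix p assume p: "p \<in> {p. p permutes {..<n}} - {p. p permutes I}"
        have "\<exists>i\<in>{..<n} - I. p i \<noteq> i"
        proof (rule ccontr)
          assume "\<not> ?thesis"
          then have "p permutes I"
            using p by (intro permutes_superset[of p "{..<n}" I]) auto
          with p show False by simp
        qed
        then have "(\<Prod>i\<in>{..<n} - I. if p i = i then 1 else 0 :: complex) = 0"
          by (intro prod_zero) auto
        then show "of_int (sign p) * ?t p I = 0" by simp
      qed
      fix p assume "p \<in> {p. p permutes I}"
      then have p: "p permutes I" by simp
      have "(\<Prod>i\<in>{..<n} - I. if p i = i then 1 else 0 :: complex) = 1"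
        using permutes_not_in[OF p] by (intro prod.neutral) auto
      moreover have "(\<Prod>i\<in>I. - (A i (p i) * d (p i))) = (\<Prod>i\<in>I. A i (p i)) * (\<Prod>i\<in>I. - d (p i))"
        by (simp flip: prod.distrib)
      moreover have "(\<Prod>i\<in>I. - d (p i)) = (\<Prod>i\<in>I. - d i)"
        using prod.reindex_bij_betw[OF permutes_imp_bij[OF p], of "\<lambda>i. - d i"] .
      ultimately show "of_int (sign p) * ?t p I =
          (\<Prod>i\<in>I. - d i) * (of_int (sign p) * (\<Prod>i\<in>I. A i (p i)))"
        by (simp add: mult_ac)
    qed
    then show "(\<Sum>p | p permutes {..<n}. of_int (sign p) * ?t p I) = (\<Prod>i\<in>I. - d i) * minor A I"
      by (simp add: minor_eq_permutes[OF I(2)] sum_distrib_left)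
  qed
  finally show ?thesis .
qed

lemma Xc_eq:
  assumes "2 \<le> n" "1 \<le> j" "j \<le> n"
  shows "Xc n A j = (\<Sum>I | I \<subseteq> {..<n} \<and> card I = j \<and> 0 \<in> I. minor A I)"
proof (cases "j = 1")
  case True
  have "{I. I \<subseteq> {..<n} \<and> card I = 1 \<and> 0 \<in> I} = {{0::nat}}"
    using assms by (auto simp: card_1_singleton_iff)
  then show ?thesis
    using True by (simp add: Xc_def minor_eq_permutes)
next
  case False
  then show ?thesis using assms by (simp add: Xc_def)
qed

text \<open>Index 0 alone carries the factor \<open>- w\<close>, every other index carries
  \<open>- z\<close>. Grouping the principal minors by cardinality and by membership of 0 therefore
  yields the sums that define \<open>Yc\<close> and \<open>Xc\<close>.\<close>

lemma detn_pencil: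
  assumes "2 \<le> n"
  shows "detn n (pencil n A w z) = Qn n z (Yc n A) - w * Pn n z (Xc n A)"
proof -
  let ?d = "\<lambda>i::nat. if i = 0 then w else z"
  let ?f = "\<lambda>I. (\<Prod>i\<in>I. - ?d i) * minor A I"
  have d0: "(\<Prod>i\<in>I. - ?d i) = (-z) ^ card I" if "0 \<notin> I" for I
  proof -
    have "(\<Prod>i\<in>I. - ?d i) = (\<Prod>i\<in>I. - z)"
      using that by (intro prod.cong) auto
    then show ?thesis by simp
  qed
  have d1: "(\<Prod>i\<in>I. - ?d i) = - w * (-z) ^ (card I - 1)" if "0 \<in> I" "finite I" for I
  proof -
    have "(\<Prod>i\<in>I. - ?d i) = - w * (\<Prod>i\<in>I - {0}. - ?d i)"
      by (subst prod.remove[OF that(2,1)]) simp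
    then show ?thesis using d0[of "I - {0}"] that by simp
  qed
  have "detn n (pencil n A w z) = (\<Sum>I\<in>Pow {..<n}. ?f I)"
    unfolding detn_id_minus_scaled[symmetric]
    by (rule detn_cong) (simp add: pencil_def mmult_struct_diag)
  also have "\<dots> = (\<Sum>I | I \<subseteq> {..<n} \<and> 0 \<notin> I. ?f I) + (\<Sum>I | I \<subseteq> {..<n} \<and> 0 \<in> I. ?f I)"
    by (subst sum.union_disjoint[symmetric]) (auto intro!: sum.cong)
  also have "(\<Sum>I | I \<subseteq> {..<n} \<and> 0 \<notin> I. ?f I) = Qn n z (Yc n A)"
  proof -
    have sub: "card ` {I. I \<subseteq> {..<n} \<and> 0 \<notin> I} \<subseteq> {..n-1}"
    proof clarsimp
      fix I assume "I \<subseteq> {..<n}" "0 \<notin> I"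
      then have "I \<subseteq> {1..<n}" by (auto simp: Suc_le_eq intro!: gr0I)
      then show "card I \<le> n - Suc 0" using card_mono[of "{1..<n}" I] by simp
    qed
    have "(\<Sum>I | I \<subseteq> {..<n} \<and> 0 \<notin> I. ?f I) =
        (\<Sum>j\<in>{..n-1}. \<Sum>I | I \<in> {I. I \<subseteq> {..<n} \<and> 0 \<notin> I} \<and> card I = j. ?f I)"
      using sub by (intro sum.group[symmetric]) auto
    also have "\<dots> = (\<Sum>j\<in>{..n-1}. (-z) ^ j * (\<Sum>I | I \<subseteq> {..<n} \<and> card I = j \<and> 0 \<notin> I. minor A I))"
      unfolding sum_distrib_left by (intro sum.cong) (auto simp: d0)
    \<comment> \<open>The empty minor is split off: it is the constant 1 in
      \<open>Qn\<close>.\<close>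
    also have "\<dots> = (\<Sum>I | I \<subseteq> {..<n} \<and> card I = 0 \<and> 0 \<notin> I. minor A I) +
        (\<Sum>j\<in>{1..n-1}. (-z) ^ j * (\<Sum>I | I \<subseteq> {..<n} \<and> card I = j \<and> 0 \<notin> I. minor A I))"
      by (subst sum.remove[of _ 0]) (auto intro!: sum.cong)
    also have "{I. I \<subseteq> {..<n} \<and> card I = 0 \<and> 0 \<notin> I} = {{}}"
      by (auto simp: card_eq_0_iff intro: finite_subset)
    finally show ?thesis
      by (simp add: Qn_def Yc_def minor_eq_permutes power_minus[of z] mult_ac)
  qed
  also have "(\<Sum>I | I \<subseteq> {..<n} \<and> 0 \<in> I. ?f I) = - w * Pn n z (Xc n A)"
  proof -
    have sub: "card ` {I. I \<subseteq> {..<n} \<and> 0 \<in> I} \<subseteq> Suc ` {..<n}"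
    proof clarify
      fix I assume I: "I \<subseteq> {..<n}" "0 \<in> I"
      then have "finite I" by (auto intro: finite_subset)
      with I have "0 < card I" "card I \<le> n"
        using card_mono[of "{..<n}" I] by (auto simp: card_gt_0_iff)
      then show "card I \<in> Suc ` {..<n}"
        by (intro image_eqI[of _ _ "card I - 1"]) auto
    qed
    have "(\<Sum>I | I \<subseteq> {..<n} \<and> 0 \<in> I. ?f I) =
        (\<Sum>j\<in>Suc ` {..<n}. \<Sum>I | I \<in> {I. I \<subseteq> {..<n} \<and> 0 \<in> I} \<and> card I = j. ?f I)"
      using sub by (intro sum.group[symmetric]) auto
    also have "\<dots> = (\<Sum>j<n. \<Sum>I | I \<in> {I. I \<subseteq> {..<n} \<and> 0 \<in> I} \<and> card I = Suc j. ?f I)"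
      by (simp add: sum.reindex)
    also have "\<dots> = (\<Sum>j<n. - w * (-z) ^ j * (\<Sum>I | I \<subseteq> {..<n} \<and> card I = Suc j \<and> 0 \<in> I. minor A I))"
      unfolding sum_distrib_left
    proof (intro sum.cong)
      fix j I assume "I \<in> {I. I \<subseteq> {..<n} \<and> card I = Suc j \<and> 0 \<in> I}"
      moreover from this have "finite I" by (auto intro: finite_subset)
      ultimately show "?f I = - w * (-z) ^ j * minor A I" by (simp add: d1)
    qed auto
    also have "\<dots> = (\<Sum>j<n. - w * (-z) ^ j * Xc n A (Suc j))"
      using assms by (intro sum.cong) (auto simp: Xc_eq)
    finally show ?thesis
      by (simp add: Pn_def sum_distrib_left sum_negf power_minus[of z] mult_ac)
  qed
  finally show ?thesis by simp
qed

section \<open>The structured singular value and membership in the domain\<close>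

lemma vnorm_struct_diag_le:
  assumes "cmod w \<le> r" "cmod z \<le> r"
  shows "vnorm n (mvec n (struct_diag n w z) v) \<le> r * vnorm n v"
proof -
  have r: "0 \<le> r" using assms norm_ge_zero order_trans by blast
  have mv: "mvec n (struct_diag n w z) v i = (if i = 0 then w else z) * v i" if "i < n" for i
  proof -
    have "(\<Sum>k<n. struct_diag n w z i k * v k) = (\<Sum>k<n. if k = i then (if i = 0 then w else z) * v i else 0)"
      using that by (intro sum.cong) (auto simp: struct_diag_def)
    then show ?thesis using that by (simp add: mvec_def)
  qed
  have "(\<Sum>i<n. (cmod (mvec n (struct_diag n w z) v i))\<^sup>2) \<le> (\<Sum>i<n. r\<^sup>2 * (cmod (v i))\<^sup>2)"
    using assms
    by (intro sum_mono) (auto simp: mv norm_mult power_mult_distrib intro!: mult_right_mono power_mono)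
  then have "vnorm n (mvec n (struct_diag n w z) v) \<le> sqrt (r\<^sup>2 * (\<Sum>i<n. (cmod (v i))\<^sup>2))"
    unfolding vnorm_def by (simp add: sum_distrib_left)
  then show ?thesis using r by (simp add: vnorm_def real_sqrt_mult)
qed

lemma vnorm_unit: "i < n \<Longrightarrow> vnorm n (\<lambda>k. if k = i then c else 0) = cmod c"
proof -
  assume "i < n"
  then have "(\<Sum>k<n. (cmod (if k = i then c else 0))\<^sup>2) = (cmod c)\<^sup>2"
    by (subst sum.remove[of _ i]) (auto intro!: sum.neutral)
  then show ?thesis by (simp add: vnorm_def)
qed

text \<open>Unit vectors at the indices 0 and 1 attain the two moduli; 2 \<le> n ensures that
  \<open>z\<close> occurs on the diagonal.\<close>

lemma opnorm_struct_diag: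
  assumes "2 \<le> n"
  shows "opnorm n (struct_diag n w z) = max (cmod w) (cmod z)"
proof -
  let ?S = "{vnorm n (mvec n (struct_diag n w z) v) | v. vnorm n v \<le> 1}"
  let ?r = "max (cmod w) (cmod z)"
  have ub: "x \<le> ?r" if "x \<in> ?S" for x
  proof -
    from that obtain v where v: "x = vnorm n (mvec n (struct_diag n w z) v)" "vnorm n v \<le> 1" by blast
    have "x \<le> ?r * vnorm n v" unfolding v by (rule vnorm_struct_diag_le) auto
    also have "\<dots> \<le> ?r * 1" using v(2) by (intro mult_left_mono) (auto simp: le_max_iff_disj)
    finally show ?thesis by simp
  qed
  have mem: "cmod (if i = 0 then w else z) \<in> ?S" if "i < n" for i
  proof -
    have "mvec n (struct_diag n w z) (\<lambda>k. if k = i then 1 else 0) =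
        (\<lambda>k. if k = i then (if i = 0 then w else z) else 0)"
    proof
      fix l
      have "(\<Sum>k<n. struct_diag n w z l k * (if k = i then 1 else 0)) = struct_diag n w z l i"
        using that by (subst sum.remove[of _ i]) (auto intro!: sum.neutral)
      then show "mvec n (struct_diag n w z) (\<lambda>k. if k = i then 1 else 0) l =
          (if l = i then (if i = 0 then w else z) else 0)"
        using that by (auto simp: mvec_def struct_diag_def)
    qed
    then show ?thesis
      using vnorm_unit[OF that, of 1] vnorm_unit[OF that, of "if i = 0 then w else z"]
      by (auto intro!: exI[of _ "\<lambda>k. if k = i then 1 else 0"])
  qed
  have bdd: "bdd_above ?S" using ub by (rule bdd_aboveI)
  have "cmod w \<le> Sup ?S" "cmod z \<le> Sup ?S"
    using mem[of 0] mem[of 1] assms by (auto intro!: cSup_upper bdd)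
  moreover have "Sup ?S \<le> ?r"
    using mem[of 0] assms ub by (intro cSup_least) auto
  ultimately show ?thesis unfolding opnorm_def by simp
qed

lemma continuous_Qn_Pn:
  "continuous_on UNIV (\<lambda>p. Qn n (snd p) y - fst p * Pn n (snd p) x)"
  unfolding Qn_def Pn_def by (intro continuous_intros)

text \<open>The left side says that an infimum over the zero set exceeds 1, the right side only that
  each of its points has maximum norm above 1. The two agree because the zero set is closed, so that
  the infimum is attained.\<close>

lemma mu_less_1_iff:
  assumes "2 \<le> n"
  shows "mu n (E1n n) A < 1 \<longleftrightarrow>
    (\<forall>z w. cmod z \<le> 1 \<and> cmod w \<le> 1 \<longrightarrow> Qn n z (Yc n A) - w * Pn n z (Xc n A) \<noteq> 0)"
proof -
  let ?g = "\<lambda>p. Qn n (snd p) (Yc n A) - fst p * Pn n (snd p) (Xc n A)"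
  define Z where "Z = {p. ?g p = 0}"
  define I where "I = Inf ((\<lambda>p. ereal (max (cmod (fst p)) (cmod (snd p)))) ` Z)"
  have "(\<lambda>X. ereal (opnorm n X)) ` {X \<in> E1n n. singular n (\<lambda>i j. idm n i j - mmult n A X i j)}
      = (\<lambda>p. ereal (max (cmod (fst p)) (cmod (snd p)))) ` Z" (is "?L = ?R")
  proof -
    have "{X \<in> E1n n. singular n (\<lambda>i j. idm n i j - mmult n A X i j)} =
        (\<lambda>p. struct_diag n (fst p) (snd p)) ` Z"
      using assms by (auto simp: E1n_eq Z_def singular_def detn_pencil simp flip: pencil_def)
        (force simp: image_iff)
    then show ?thesis
      using assms by (simp add: image_image opnorm_struct_diag)
  qed
  then have mu: "mu n (E1n n) A = inverse I"
    by (simp add: mu_def I_def)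
  have I0: "0 \<le> I"
    unfolding I_def by (rule Inf_greatest) (auto simp: le_max_iff_disj)
  \<comment> \<open>In \<open>ereal\<close> the inverse of 0 is \<infinity> and the inverse of
    \<infinity> is 0, so the equivalence also holds at both boundary values.\<close>
  have "mu n (E1n n) A < 1 \<longleftrightarrow> 1 < I"
  proof (cases I)
    case (real r)
    with I0 show ?thesis
      by (cases "r = 0") (auto simp: mu field_simps)
  qed (use I0 in \<open>auto simp: mu\<close>)
  also have "\<dots> \<longleftrightarrow> (\<forall>p\<in>Z. 1 < max (cmod (fst p)) (cmod (snd p)))"
  proof
    assume I1: "1 < I"
    show "\<forall>p\<in>Z. 1 < max (cmod (fst p)) (cmod (snd p))"
    proof
      fix p assume "p \<in> Z"
      then have "I \<le> ereal (max (cmod (fst p)) (cmod (snd p)))"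
        unfolding I_def by (intro Inf_lower) auto
      with I1 have "1 < ereal (max (cmod (fst p)) (cmod (snd p)))" by (rule less_le_trans)
      then show "1 < max (cmod (fst p)) (cmod (snd p))" by (simp only: one_ereal_def less_ereal.simps)
    qed
  next
    assume *: "\<forall>p\<in>Z. 1 < max (cmod (fst p)) (cmod (snd p))"
    show "1 < I"
    proof (cases "Z = {}")
      case True
      then show ?thesis by (simp add: I_def top_ereal_def)
    next
      case False
      have "closed Z"
        unfolding Z_def using continuous_Qn_Pn[of n "Yc n A" "Xc n A"]
        by (intro closed_Collect_eq) auto
      let ?h = "\<lambda>p::complex \<times> complex. max (cmod (fst p)) (cmod (snd p))"
      obtain q where q: "q \<in> Z" using False by blast
      \<comment> \<open>A point of \<open>Z\<close> outside this compact piece has maximum norm at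
        least that of \<open>q\<close>, so a minimum over \<open>K\<close> is one over
        \<open>Z\<close>.\<close>
      define K where "K = Z \<inter> cball 0 (?h q) \<times> cball 0 (?h q)"
      have "compact K"
        unfolding K_def by (intro closed_Int_compact compact_Times \<open>closed Z\<close>) auto
      moreover have qK: "q \<in> K"
        using q by (cases q) (auto simp: K_def)
      moreover have "continuous_on K ?h" by (intro continuous_intros)
      ultimately have "\<exists>p\<in>K. \<forall>p'\<in>K. ?h p \<le> ?h p'"
        by (intro continuous_attains_inf) auto
      then obtain p where p: "p \<in> K" "\<And>p'. p' \<in> K \<Longrightarrow> ?h p \<le> ?h p'" by blast
      have "?h p \<le> ?h p'" if "p' \<in> Z" for p'
      proof (cases "p' \<in> K")
        case False
        then have "?h q \<le> ?h p'"
          using that by (cases p') (auto simp: K_def)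
        with p(2)[OF qK] show ?thesis by (rule order_trans)
      qed (use p in auto)
      then have "ereal (?h p) \<le> I"
        unfolding I_def by (intro Inf_greatest) (auto simp only: ereal_less_eq image_iff)
      moreover have "1 < ?h p" using * p(1) by (simp add: K_def)
      ultimately show ?thesis
        by (intro less_le_trans[of 1 "ereal (?h p)" I]) (simp_all only: one_ereal_def less_ereal.simps)
    qed
  qed
  also have "\<dots> \<longleftrightarrow> (\<forall>z w. cmod z \<le> 1 \<and> cmod w \<le> 1 \<longrightarrow> Qn n z (Yc n A) - w * Pn n z (Xc n A) \<noteq> 0)"
  proof (intro iffI allI impI ballI)
    fix z w assume *: "\<forall>p\<in>Z. 1 < max (cmod (fst p)) (cmod (snd p))" and zw: "cmod z \<le> 1 \<and> cmod w \<le> 1"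
    have "(w, z) \<notin> Z" using bspec[OF *, of "(w, z)"] zw by auto
    then show "Qn n z (Yc n A) - w * Pn n z (Xc n A) \<noteq> 0" by (simp add: Z_def)
  next
    fix p assume *: "\<forall>z w. cmod z \<le> 1 \<and> cmod w \<le> 1 \<longrightarrow> Qn n z (Yc n A) - w * Pn n z (Xc n A) \<noteq> 0" and "p \<in> Z"
    then have "\<not> (cmod (snd p) \<le> 1 \<and> cmod (fst p) \<le> 1)" by (auto simp: Z_def)
    then show "1 < max (cmod (fst p)) (cmod (snd p))" by auto
  qed
  finally show ?thesis .
qed

lemma Omega_iff:
  assumes "2 \<le> n"
  shows "A \<in> Omega n \<longleftrightarrow> A \<in> mats n \<and> pin n A \<in> G1n n"
  using mu_less_1_iff[OF assms] assms by (auto simp: Omega_def G1n_def pin_def Xc_def Yc_def)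

text \<open>The values w = 0 and w = 1 separate the two polynomials, whose coefficients are then
  compared; the support hypotheses settle the indices that no coefficient sees.\<close>

lemma Qn_Pn_cancel:
  assumes x: "\<And>j. j < 1 \<or> n < j \<Longrightarrow> x j = 0" "\<And>j. j < 1 \<or> n < j \<Longrightarrow> x' j = 0"
    and y: "\<And>j. j < 1 \<or> n - 1 < j \<Longrightarrow> y j = 0" "\<And>j. j < 1 \<or> n - 1 < j \<Longrightarrow> y' j = 0"
    and eq: "\<And>z w. Qn n z y - w * Pn n z x = Qn n z y' - w * Pn n z x'"
  shows "x = x' \<and> y = y'"
proof -
  have Q: "Qn n z y = Qn n z y'" for z using eq[of z 0] by simp
  have P: "Pn n z x = Pn n z x'" for z using eq[of z 1] Q[of z] by simp
  have "(\<Sum>j\<le>n-1. (-1)^j * y j * z ^ j) = (\<Sum>j\<le>n-1. (-1)^j * y' j * z ^ j)" for z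
  proof -
    have "(\<Sum>j\<le>n-1. (-1)^j * u j * z ^ j) = Qn n z u - 1" if "u 0 = 0" for u
      unfolding Qn_def using that by (subst sum.remove[of _ 0]) (auto intro!: sum.cong)
    then show ?thesis using Q y by simp
  qed
  then have Y: "(-1)^j * y j = (-1)^j * y' j" if "j \<le> n-1" for j
    using polyfun_eq_coeffs[of "\<lambda>j. (-1)^j * y j" "n-1" "\<lambda>j. (-1)^j * y' j"] that by blast
  \<comment> \<open>A zero coefficient at \<open>n\<close> pads the sum to the closed range that
    \<open>polyfun_eq_coeffs\<close> expects.\<close>
  have "(\<Sum>j\<le>n. (if j < n then (-1)^j * x (Suc j) else 0) * z ^ j) =
      (\<Sum>j\<le>n. (if j < n then (-1)^j * x' (Suc j) else 0) * z ^ j)" for z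
  proof -
    have "(\<Sum>j\<le>n. (if j < n then (-1)^j * u (Suc j) else 0) * z ^ j) = Pn n z u" for u
      unfolding Pn_def by (rule sum.mono_neutral_cong_right) auto
    then show ?thesis using P by simp
  qed
  then have X: "(-1)^j * x (Suc j) = (-1)^j * x' (Suc j)" if "j < n" for j
    using polyfun_eq_coeffs[of "\<lambda>j. if j < n then (-1)^j * x (Suc j) else 0" n
        "\<lambda>j. if j < n then (-1)^j * x' (Suc j) else 0"] that
    by (metis (no_types, lifting) less_imp_le)
  have "x j = x' j" for j
    using X[of "j - 1"] x[of j] by (cases "j < 1 \<or> n < j") auto
  moreover have "y j = y' j" for j
    using Y[of j] y[of j] by (cases "j < 1 \<or> n - 1 < j") auto
  ultimately show ?thesis by blast
qed

text \<open>The way in which \<open>pin\<close> is computed from here on: any evaluation of the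
  determinant of the pencil reveals it.\<close>

lemma pin_eqI:
  assumes "2 \<le> n" "\<And>j. j < 1 \<or> n < j \<Longrightarrow> x j = 0" "\<And>j. j < 1 \<or> n - 1 < j \<Longrightarrow> y j = 0"
    and "\<And>z w. detn n (pencil n A w z) = Qn n z y - w * Pn n z x"
  shows "pin n A = (x, y)"
proof -
  have "Xc n A j = 0" if "j < 1 \<or> n < j" for j using that assms(1) by (auto simp: Xc_def)
  moreover have "Yc n A j = 0" if "j < 1 \<or> n - 1 < j" for j using that by (auto simp: Yc_def)
  ultimately have "Xc n A = x \<and> Yc n A = y"
    using assms(2-4) by (intro Qn_Pn_cancel[of n]) (simp_all flip: detn_pencil[OF assms(1)])
  then show ?thesis by (simp add: pin_def)
qed

subsection \<open>Conjugation by block matrices\<close>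

text \<open>The matrices of the form \<open>[1] \<oplus> S\<close>, which commute with all of \<open>E1n\<close>.\<close>

definition block :: "nat \<Rightarrow> cmat \<Rightarrow> bool" where
  "block n M \<longleftrightarrow> (\<forall>i. M i 0 = idm n i 0) \<and> (\<forall>j. M 0 j = idm n 0 j)"

text \<open>The inverse is carried along as data, so that its holomorphy and its values at the nodes
  can be stated like those of the matrix itself.\<close>

definition block_inverses :: "nat \<Rightarrow> cmat \<Rightarrow> cmat \<Rightarrow> bool" where
  "block_inverses n M M' \<longleftrightarrow> M \<in> mats n \<and> M' \<in> mats n \<and> block n M \<and> block n M' \<and>
     mmult n M M' = idm n \<and> mmult n M' M = idm n"

lemma mmult_in_mats: "A \<in> mats n \<Longrightarrow> B \<in> mats n \<Longrightarrow> mmult n A B \<in> mats n"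
  by (auto simp: mats_def mmult_def)

lemma idm_in_mats: "idm n \<in> mats n"
  by (auto simp: mats_def idm_def)

lemma mats_eqI:
  assumes "A \<in> mats n" "B \<in> mats n" "\<And>i j. i < n \<Longrightarrow> j < n \<Longrightarrow> A i j = B i j"
  shows "A = B"
proof (intro ext)
  fix i j show "A i j = B i j"
    using assms by (cases "i < n \<and> j < n") (auto simp: mats_def not_less)
qed

lemma mmult_assoc: "mmult n (mmult n A B) C = mmult n A (mmult n B C)"
proof (intro ext)
  fix i j
  have "(\<Sum>k<n. (\<Sum>l<n. A i l * B l k) * C k j) = (\<Sum>k<n. \<Sum>l<n. A i l * B l k * C k j)"
    by (simp add: sum_distrib_right)
  also have "\<dots> = (\<Sum>l<n. \<Sum>k<n. A i l * B l k * C k j)" by (rule sum.swap)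
  finally show "mmult n (mmult n A B) C i j = mmult n A (mmult n B C) i j"
    by (simp add: mmult_def sum_distrib_left mult.assoc)
qed

lemma sum_idm_left: "(\<Sum>k<n. idm n i k * f k) = (if i < n then f i else 0)"
proof -
  have "(\<Sum>k<n. idm n i k * f k) = (\<Sum>k<n. if k = i then f i else 0)"
    by (rule sum.cong) (auto simp: idm_def)
  then show ?thesis by simp
qed

lemma sum_idm_right: "(\<Sum>k<n. f k * idm n k i) = (if i < n then f i else 0)"
proof -
  have "(\<Sum>k<n. f k * idm n k i) = (\<Sum>k<n. if k = i then f i else 0)"
    by (rule sum.cong) (auto simp: idm_def)
  then show ?thesis by simp
qed

lemma mmult_idm_left: "A \<in> mats n \<Longrightarrow> mmult n (idm n) A = A"
  by (intro ext) (auto simp: mmult_def sum_idm_left mats_def)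

lemma mmult_idm_right: "A \<in> mats n \<Longrightarrow> mmult n A (idm n) = A"
  by (intro ext) (auto simp: mmult_def sum_idm_right mats_def)

lemma block_idm: "block n (idm n)"
  by (simp add: block_def)

lemma block_inverses_idm: "block_inverses n (idm n) (idm n)"
  by (simp add: block_inverses_def idm_in_mats block_idm mmult_idm_left)

lemma block_inverses_sym: "block_inverses n M M' \<Longrightarrow> block_inverses n M' M"
  by (auto simp: block_inverses_def)

lemma block_mmult:
  assumes "block n A" "block n B" "A \<in> mats n" "B \<in> mats n"
  shows "block n (mmult n A B)"
proof -
  have "mmult n A B i 0 = (\<Sum>k<n. A i k * idm n k 0)" for i
    using assms by (simp add: mmult_def block_def)
  moreover have "mmult n A B 0 j = (\<Sum>k<n. idm n 0 k * B k j)" for j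
    using assms by (simp add: mmult_def block_def)
  ultimately show ?thesis
    using assms(1,2) unfolding sum_idm_left sum_idm_right by (auto simp: block_def idm_def)
qed

lemma block_inverses_mmult:
  assumes "block_inverses n A A'" "block_inverses n B B'"
  shows "block_inverses n (mmult n A B) (mmult n B' A')"
proof -
  have "mmult n (mmult n A B) (mmult n B' A') = mmult n A (mmult n (mmult n B B') A')"
    by (simp add: mmult_assoc)
  also have "\<dots> = idm n" using assms by (simp add: block_inverses_def mmult_idm_left)
  finally have 1: "mmult n (mmult n A B) (mmult n B' A') = idm n" .
  have "mmult n (mmult n B' A') (mmult n A B) = mmult n B' (mmult n (mmult n A' A) B)"
    by (simp add: mmult_assoc)
  also have "\<dots> = idm n" using assms by (simp add: block_inverses_def mmult_idm_left)
  finally show ?thesis using 1 assms by (simp add: block_inverses_def mmult_in_mats block_mmult)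
qed

lemma mmult_right_inverse_imp_left:
  assumes "A \<in> mats n" "B \<in> mats n" "mmult n A B = idm n"
  shows "mmult n B A = idm n"
proof (rule mats_eqI)
  let ?m = "\<lambda>A. Matrix.mat n n (\<lambda>(i, j). A i j)"
  have "?m A * ?m B = 1\<^sub>m n"
    using assms(3) by (simp flip: mat_mmult mat_idm)
  then have "?m B * ?m A = 1\<^sub>m n"
    by (rule mat_mult_left_right_inverse[rotated 2]) auto
  then have "?m (mmult n B A) = ?m (idm n)" by (simp add: mat_mmult mat_idm)
  then show "mmult n B A i j = idm n i j" if "i < n" "j < n" for i j
    using that by (metis (no_types, lifting) index_mat(1) old.prod.case)
qed (use assms in \<open>auto simp: mmult_in_mats idm_in_mats\<close>)

text \<open>Row 0 of \<open>M M'\<close> is row 0 of \<open>M'\<close>, and column 0 of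
  \<open>M' M\<close> is column 0 of \<open>M'\<close>, because \<open>M\<close> is block; so the
  inverse inherits the block form.\<close>

lemma block_inversesI:
  assumes M: "M \<in> mats n" "block n M" and M': "M' \<in> mats n" and eq: "mmult n M M' = idm n" and "0 < n"
  shows "block_inverses n M M'"
proof -
  have eq': "mmult n M' M = idm n" using M(1) M' eq by (rule mmult_right_inverse_imp_left)
  have "M' 0 j = idm n 0 j" for j
  proof -
    have "mmult n M M' 0 j = (if 0 < n then M' 0 j else 0)"
      using M(2) by (simp add: mmult_def block_def sum_idm_left)
    then show ?thesis using eq \<open>0 < n\<close> by simp
  qed
  moreover have "M' i 0 = idm n i 0" for i
  proof -
    have "mmult n M' M i 0 = (if 0 < n then M' i 0 else 0)"
      using M(2) by (simp add: mmult_def block_def sum_idm_right)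
    then show ?thesis using eq' \<open>0 < n\<close> by simp
  qed
  ultimately show ?thesis using M M' eq eq' by (simp add: block_inverses_def block_def)
qed

text \<open>The structured matrix is scalar on each of the two blocks that \<open>M\<close>
  respects.\<close>

lemma block_commute_struct_diag:
  assumes "block n M" "M \<in> mats n"
  shows "mmult n M (struct_diag n w z) = mmult n (struct_diag n w z) M"
proof (intro ext)
  fix i j
  have "mmult n (struct_diag n w z) M i j = (\<Sum>k<n. idm n i k * ((if i = 0 then w else z) * M k j))"
    unfolding mmult_def by (rule sum.cong) (auto simp: struct_diag_def idm_def)
  also have "\<dots> = mmult n M (struct_diag n w z) i j"
    using assms unfolding sum_idm_left by (auto simp: mmult_struct_diag block_def mats_def idm_def)
  finally show "mmult n M (struct_diag n w z) i j = mmult n (struct_diag n w z) M i j" by simp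
qed

definition conj_by :: "nat \<Rightarrow> cmat \<Rightarrow> cmat \<Rightarrow> cmat \<Rightarrow> cmat" where
  "conj_by n M M' B = mmult n (mmult n M B) M'"

lemma conj_by_in_mats: "block_inverses n M M' \<Longrightarrow> B \<in> mats n \<Longrightarrow> conj_by n M M' B \<in> mats n"
  by (simp add: conj_by_def block_inverses_def mmult_in_mats)

lemma mmult_diff_right:
  "mmult n A (\<lambda>i j. B i j - C i j) = (\<lambda>i j. mmult n A B i j - mmult n A C i j)"
  by (simp add: mmult_def algebra_simps sum_subtractf)

lemma mmult_diff_left:
  "mmult n (\<lambda>i j. B i j - C i j) A = (\<lambda>i j. mmult n B A i j - mmult n C A i j)"
  by (simp add: mmult_def algebra_simps sum_subtractf)

lemma pencil_conj_by:
  assumes "block_inverses n M M'"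
  shows "pencil n (conj_by n M M' B) w z = conj_by n M M' (pencil n B w z)"
proof -
  let ?D = "struct_diag n w z"
  have "mmult n (conj_by n M M' B) ?D = mmult n (mmult n M B) (mmult n M' ?D)"
    by (simp add: conj_by_def mmult_assoc)
  also have "mmult n M' ?D = mmult n ?D M'"
    using assms by (intro block_commute_struct_diag) (auto simp: block_inverses_def)
  finally have 1: "mmult n (conj_by n M M' B) ?D = conj_by n M M' (mmult n B ?D)"
    by (simp add: conj_by_def mmult_assoc)
  have "idm n = conj_by n M M' (idm n)"
    using assms by (simp add: conj_by_def block_inverses_def mmult_idm_right)
  then show ?thesis
    unfolding pencil_def 1 by (simp add: conj_by_def mmult_diff_left mmult_diff_right)
qed

text \<open>Since \<open>M'\<close> commutes with the structured matrices, conjugating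
  \<open>B\<close> conjugates its whole pencil; the determinant, and with it \<open>pin\<close>,
  stays the same.\<close>

lemma pin_conj_by:
  assumes "2 \<le> n" "block_inverses n M M'"
  shows "pin n (conj_by n M M' B) = pin n B"
proof -
  have "detn n M * detn n M' = detn n (idm n)"
    using assms(2) by (simp add: block_inverses_def flip: detn_mmult)
  then have "detn n (pencil n (conj_by n M M' B) w z) = detn n (pencil n B w z)" for w z
    unfolding pencil_conj_by[OF assms(2)] by (simp add: conj_by_def detn_mmult detn_idm)
  then have "pin n (conj_by n M M' B) = (Xc n B, Yc n B)"
    by (intro pin_eqI) (auto simp: assms detn_pencil, (use assms in \<open>auto simp: Xc_def Yc_def\<close>))
  then show ?thesis by (simp add: pin_def)
qed

subsection \<open>The canonical form\<close>

text \<open>Without row and column 0 this is a companion matrix with its coefficients in the top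
  row, and below the corner the first column is the first unit vector, which is cyclic for it. In
  row 0 the term \<open>- x 1 * y j\<close> compensates the product of the corner entry with
  \<open>Qn\<close> that arises in the determinant of the pencil.\<close>

definition canon :: "nat \<Rightarrow> cvec \<Rightarrow> cvec \<Rightarrow> cmat" where
  "canon n x y = (\<lambda>i j. if i < n \<and> j < n then
      (if i = 0 then (if j = 0 then x 1 else (-1) ^ j * (x (Suc j) - x 1 * y j))
       else if i = 1 then (if j = 0 then 1 else - ((-1) ^ j * y j))
       else if i = Suc j then 1 else 0)
     else 0)"

lemma canon_in_mats: "canon n x y \<in> mats n"
  by (auto simp: canon_def mats_def)

text \<open>Shape of the pencil of \<open>canon\<close> once column 1 has been cleared from row 2
  on: the trailing block is lower triangular with unit diagonal, so only the leading 2 by 2 block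
  contributes.\<close>

lemma detn_block_upper:
  assumes "2 \<le> n"
    and lower: "\<And>i j. 2 \<le> i \<Longrightarrow> i < n \<Longrightarrow> j < 2 \<Longrightarrow> A i j = 0"
    and tri: "\<And>i j. 2 \<le> i \<Longrightarrow> i < j \<Longrightarrow> j < n \<Longrightarrow> A i j = 0"
    and diag: "\<And>i. 2 \<le> i \<Longrightarrow> i < n \<Longrightarrow> A i i = 1"
  shows "detn n A = A 0 0 * A 1 1 - A 0 1 * A 1 0"
proof -
  obtain m where m: "n = 2 + m" using assms(1) le_Suc_ex by blast
  let ?A1 = "Matrix.mat 2 2 (\<lambda>(i, j). A i j)"
  let ?A2 = "Matrix.mat 2 m (\<lambda>(i, j). A i (2 + j))"
  let ?A4 = "Matrix.mat m m (\<lambda>(i, j). A (2 + i) (2 + j))"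
  have "Matrix.mat n n (\<lambda>(i, j). A i j) = four_block_mat ?A1 ?A2 (0\<^sub>m m 2) ?A4"
  proof (rule eq_matI)
    have 2: "Suc (Suc (i - 2)) = i" if "\<not> i < 2" for i using that by simp
    fix i j
    assume "i < dim_row (four_block_mat ?A1 ?A2 (0\<^sub>m m 2) ?A4)"
      and "j < dim_col (four_block_mat ?A1 ?A2 (0\<^sub>m m 2) ?A4)"
    then show "Matrix.mat n n (\<lambda>(i, j). A i j) $$ (i, j) = four_block_mat ?A1 ?A2 (0\<^sub>m m 2) ?A4 $$ (i, j)"
      by (auto simp: m lower 2)
  qed (auto simp: m)
  then have "detn n A = Determinant.det ?A1 * Determinant.det ?A4"
    unfolding detn_eq_det by (simp add: det_four_block_mat_lower_left_zero[of _ 2 _ m])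
  also have "Determinant.det ?A4 = prod_list (diag_mat ?A4)"
    by (rule det_lower_triangular[of m]) (auto simp: tri m)
  also have "\<dots> = 1"
    unfolding prod_list_diag_prod by (rule prod.neutral) (auto simp: diag m)
  also have "Determinant.det ?A1 = A 0 0 * A 1 1 - A 0 1 * A 1 0"
  proof -
    have two: "{..<2::nat} = {0, 1}" by auto
    have "{p. p permutes {..<2::nat}} = {id, Transposition.transpose 0 1}"
      unfolding two using permutes_doubleton_iff[of _ 0 "1::nat"] by auto
    moreover have "Transposition.transpose 0 (1::nat) \<noteq> id"
      by (metis id_apply transpose_apply_first zero_neq_one)
    moreover have "(\<Prod>i<2. A i (p i)) = A 0 (p 0) * A 1 (p 1)" for p
      unfolding two by simp
    ultimately have "detn 2 A = A 0 0 * A 1 1 - A 0 1 * A 1 0"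
      unfolding detn_def by (simp add: sign_swap_id)
    then show ?thesis by (simp add: detn_eq_det)
  qed
  finally show ?thesis by simp
qed

lemma detn_pencil_canon:
  assumes "2 \<le> n"
  shows "detn n (pencil n (canon n x y) w z) = Qn n z y - w * Pn n z x"
proof -
  define N where "N = pencil n (canon n x y) w z"
  \<comment> \<open>Multiplication by \<open>V\<close> replaces column 1 by the sum of the columns \<open>l \<ge> 1\<close> weighted with \<open>z ^ (l - 1)\<close>,
    which telescopes along the subdiagonal.\<close>
  define V :: cmat where "V = (\<lambda>i j. if j = 1 then (if 0 < i then z ^ (i - 1) else 0) else idm n i j)"
  define K where "K = mmult n N V"
  have "Determinant.det (Matrix.mat n n (\<lambda>(i, j). V i j)) = prod_list (diag_mat (Matrix.mat n n (\<lambda>(i, j). V i j)))"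
    by (rule det_lower_triangular[of n]) (auto simp: V_def idm_def)
  also have "\<dots> = 1"
    unfolding prod_list_diag_prod by (rule prod.neutral) (auto simp: V_def idm_def)
  finally have detV: "detn n V = 1" by (simp add: detn_eq_det)
  have Ne: "N i j = idm n i j - (if j < n then canon n x y i j * (if j = 0 then w else z) else 0)" for i j
    by (simp add: N_def pencil_def mmult_struct_diag)
  have K: "K i j = N i j" if "j \<noteq> 1" "j < n" for i j
    using that by (simp add: K_def mmult_def V_def sum_idm_right)
  have K1: "K i 1 = (\<Sum>l\<in>{1..n-1}. N i l * z ^ (l - 1))" for i
    unfolding K_def mmult_def V_def using assms
    by (intro sum.mono_neutral_cong_right) auto
  have zl: "z * z ^ (l - 1) = z ^ l" if "1 \<le> l" for l
    using that by (simp flip: power_Suc)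
  have K01: "K 0 1 = - (\<Sum>l\<in>{1..n-1}. (-1) ^ l * (x (Suc l) - x 1 * y l) * z ^ l)"
    unfolding K1 sum_negf[symmetric]
  proof (rule sum.cong[OF refl])
    fix l assume l: "l \<in> {1..n-1}"
    moreover from this have "l < n" using assms by auto
    ultimately have "N 0 l * z ^ (l - 1) = - ((-1) ^ l * (x (Suc l) - x 1 * y l)) * (z * z ^ (l - 1))"
      using assms by (simp add: Ne canon_def idm_def)
    then show "N 0 l * z ^ (l - 1) = - ((-1) ^ l * (x (Suc l) - x 1 * y l) * z ^ l)"
      using zl l by simp
  qed
  have K11: "K 1 1 = Qn n z y"
  proof -
    have "N 1 l * z ^ (l - 1) = idm n 1 l * z ^ (l - 1) + (-1) ^ l * y l * z ^ l"
      if l: "l \<in> {1..n-1}" for l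
    proof -
      have "l < n" using l assms by auto
      with l have "N 1 l * z ^ (l - 1) = idm n 1 l * z ^ (l - 1) + (-1) ^ l * y l * (z * z ^ (l - 1))"
        using assms l by (simp add: Ne canon_def algebra_simps)
      then show ?thesis using zl l by simp
    qed
    then have "K 1 1 = (\<Sum>l\<in>{1..n-1}. idm n 1 l * z ^ (l - 1)) + (\<Sum>l\<in>{1..n-1}. (-1) ^ l * y l * z ^ l)"
      unfolding K1 sum.distrib[symmetric] by (rule sum.cong[OF refl])
    also have "(\<Sum>l\<in>{1..n-1}. idm n 1 l * z ^ (l - 1)) = 1"
      using assms by (subst sum.remove[of _ 1]) (auto simp: idm_def intro!: sum.neutral)
    finally show ?thesis by (simp add: Qn_def)
  qed
  have Ki1: "K i 1 = 0" if "2 \<le> i" "i < n" for i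
  proof -
    have "K i 1 = N i i * z ^ (i - 1) + (N i (i - 1) * z ^ (i - 1 - 1) +
        (\<Sum>l\<in>{1..n-1} - {i} - {i-1}. N i l * z ^ (l - 1)))"
      unfolding K1 using that
      by (subst sum.remove[of _ i], simp, simp, subst sum.remove[of _ "i - 1"]) auto
    moreover have "(\<Sum>l\<in>{1..n-1} - {i} - {i-1}. N i l * z ^ (l - 1)) = 0"
      using that by (intro sum.neutral) (auto simp: Ne canon_def idm_def)
    moreover have "N i i = 1" using that by (auto simp: Ne canon_def idm_def)
    moreover have "N i (i - 1) = - z" using that by (auto simp: Ne canon_def idm_def)
    moreover have "z ^ (i - 1) = z * z ^ (i - 1 - 1)" using zl[of "i - 1"] that by simp
    ultimately show ?thesis by simp
  qed
  have "detn n N = detn n K"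
    by (simp add: K_def detn_mmult detV)
  also have "\<dots> = K 0 0 * K 1 1 - K 0 1 * K 1 0"
  proof (rule detn_block_upper[OF assms])
    fix i j assume "2 \<le> i" "i < n" "j < (2::nat)"
    then show "K i j = 0"
      by (cases "j = 1") (use Ki1 assms in \<open>auto simp: K Ne canon_def idm_def\<close>)
  qed (auto simp: K Ne canon_def idm_def)
  also have "K 0 0 = 1 - w * x 1" using assms by (simp add: K Ne canon_def idm_def)
  also have "K 1 0 = - w" using assms by (simp add: K Ne canon_def idm_def)
  finally have "detn n N = (1 - w * x 1) * Qn n z y
      - w * (\<Sum>l\<in>{1..n-1}. (-1) ^ l * (x (Suc l) - x 1 * y l) * z ^ l)"
    unfolding K01 K11 by simp
  moreover have "(\<Sum>l\<in>{1..n-1}. (-1) ^ l * (x (Suc l) - x 1 * y l) * z ^ l) =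
     (\<Sum>l\<in>{1..n-1}. (-1) ^ l * x (Suc l) * z ^ l) - x 1 * (\<Sum>l\<in>{1..n-1}. (-1) ^ l * y l * z ^ l)"
    by (simp add: sum_subtractf sum_distrib_left algebra_simps)
  moreover have "(\<Sum>l\<in>{1..n-1}. (-1) ^ l * x (Suc l) * z ^ l) = Pn n z x - x 1"
  proof -
    have "Pn n z x = x 1 + (\<Sum>l\<in>{..<n} - {0}. (-1) ^ l * x (Suc l) * z ^ l)"
      unfolding Pn_def using assms by (subst sum.remove[of _ 0]) simp_all
    moreover have "{..<n} - {0} = {1..n-1}" using assms by auto
    ultimately show ?thesis by simp
  qed
  moreover have "(\<Sum>l\<in>{1..n-1}. (-1) ^ l * y l * z ^ l) = Qn n z y - 1"
    by (simp add: Qn_def)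
  \<comment> \<open>The inner bracket equals P - x_1 Q, so the terms w x_1 Q cancel and Q - w P
    remains.\<close>
  ultimately have "detn n N = (1 - w * x 1) * Qn n z y - w * ((Pn n z x - x 1) - x 1 * (Qn n z y - 1))"
    by (simp only:)
  then show ?thesis unfolding N_def by (simp add: algebra_simps)
qed

lemma pin_canon:
  assumes "2 \<le> n" "\<And>j. j < 1 \<or> n < j \<Longrightarrow> x j = 0" "\<And>j. j < 1 \<or> n - 1 < j \<Longrightarrow> y j = 0"
  shows "pin n (canon n x y) = (x, y)"
  using assms by (intro pin_eqI detn_pencil_canon) auto

lemma pin_image_Omega:
  assumes "2 \<le> n"
  shows "pin n ` Omega n = G1n n"
proof (intro equalityI subsetI)
  fix p assume p: "p \<in> G1n n"
  obtain x y where xy: "p = (x, y)" by (cases p)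
  have "pin n (canon n x y) = (x, y)"
    using p assms by (intro pin_canon) (auto simp: G1n_def xy)
  then show "p \<in> pin n ` Omega n"
    using p xy by (intro image_eqI[of _ _ "canon n x y"]) (auto simp: Omega_iff[OF assms] canon_in_mats)
qed (use Omega_iff[OF assms] in blast)

subsection \<open>Normal form of matrices with a cyclic first column\<close>

lemma mvec_linear:
  "mvec k A (\<lambda>i. \<Sum>l\<in>L. c l * v l i) = (\<lambda>i. \<Sum>l\<in>L. c l * mvec k A (v l) i)"
proof
  fix i
  have "(\<Sum>m<k. A i m * (\<Sum>l\<in>L. c l * v l m)) = (\<Sum>m<k. \<Sum>l\<in>L. c l * (A i m * v l m))"
    by (simp add: sum_distrib_left mult_ac)
  also have "\<dots> = (\<Sum>l\<in>L. \<Sum>m<k. c l * (A i m * v l m))" by (rule sum.swap)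
  finally show "mvec k A (\<lambda>i. \<Sum>l\<in>L. c l * v l i) i = (\<Sum>l\<in>L. c l * mvec k A (v l) i)"
    by (simp add: mvec_def sum_distrib_left)
qed

lemma mvec_diff: "mvec k A (\<lambda>i. u i - v i) = (\<lambda>i. mvec k A u i - mvec k A v i)"
  by (simp add: mvec_def algebra_simps sum_subtractf)

text \<open>The vectors \<open>V 0 = c\<close>, \<open>V (j+1) = A (V j) - \<gamma> (j+1) c\<close>, where \<open>\<gamma>\<close> comes from the
  expansion of \<open>A^k c\<close>, form a basis in which \<open>A\<close> is a companion matrix with its coefficients in
  the first row.\<close>

lemma companion_basis:
  assumes cyc: "cyclic_vec k A c"
  obtains V :: "nat \<Rightarrow> cvec" and \<gamma> :: cvec where
    "V 0 = c"
    "\<And>j i. j < k \<Longrightarrow> i < k \<Longrightarrow> mvec k A (V j) i = \<gamma> (Suc j) * c i + (if Suc j < k then V (Suc j) i else 0)"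
    "\<And>w. \<exists>d. \<forall>i<k. w i = (\<Sum>l<k. d l * V l i)"
proof -
  define \<kappa> where "\<kappa> m = (mvec k A ^^ m) c" for m
  have \<kappa>0: "\<kappa> 0 = c" and \<kappa>Suc: "\<And>m. \<kappa> (Suc m) = mvec k A (\<kappa> m)"
    by (simp_all add: \<kappa>_def)
  obtain \<beta> where \<beta>: "\<And>i. i < k \<Longrightarrow> \<kappa> k i = (\<Sum>m<k. \<beta> m * \<kappa> m i)"
    using cyc unfolding cyclic_vec_def \<kappa>_def by meson
  \<comment> \<open>The reversal of indices makes \<gamma> l the coefficient of A^(k-l) c, so that
    \<open>V k\<close> is A^k c minus its own expansion and vanishes.\<close>
  define \<gamma> where "\<gamma> l = \<beta> (k - l)" for l
  define V where "V j i = \<kappa> j i - (\<Sum>l\<in>{1..j}. \<gamma> l * \<kappa> (j - l) i)" for j i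
  have V0: "V 0 = c" by (simp add: V_def \<kappa>0 fun_eq_iff)
  have VSuc: "mvec k A (V j) i = V (Suc j) i + \<gamma> (Suc j) * c i" for j i
  proof -
    have "mvec k A (V j) i = \<kappa> (Suc j) i - (\<Sum>l\<in>{1..j}. \<gamma> l * \<kappa> (Suc (j - l)) i)"
      unfolding V_def mvec_diff mvec_linear \<kappa>Suc ..
    also have "(\<Sum>l\<in>{1..j}. \<gamma> l * \<kappa> (Suc (j - l)) i) = (\<Sum>l\<in>{1..j}. \<gamma> l * \<kappa> (Suc j - l) i)"
      by (rule sum.cong) (auto simp: Suc_diff_le)
    also have "\<dots> = (\<Sum>l\<in>{1..Suc j}. \<gamma> l * \<kappa> (Suc j - l) i) - \<gamma> (Suc j) * c i"
      by (simp add: \<kappa>0)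
    finally show ?thesis by (simp add: V_def[of "Suc j"])
  qed
  have Vk: "V k i = 0" if "i < k" for i
  proof -
    have "(\<Sum>l\<in>{1..k}. \<gamma> l * \<kappa> (k - l) i) = (\<Sum>m<k. \<beta> m * \<kappa> m i)"
      by (rule sum.reindex_bij_witness[where i = "\<lambda>m. k - m" and j = "\<lambda>l. k - l"]) (auto simp: \<gamma>_def)
    then show ?thesis using \<beta>[OF that] by (simp add: V_def)
  qed
  \<comment> \<open>\<open>V m\<close> differs from \<open>\<kappa> m\<close> by a combination of
    earlier iterates. The passage between the two families is unitriangular and can be inverted by
    induction.\<close>
  have \<kappa>V: "\<exists>d. \<forall>i<k. \<kappa> m i = (\<Sum>l<k. d l * V l i)" if "m < k" for m
    using that
  proof (induction m rule: less_induct)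
    case (less m)
    have "\<exists>d. 1 \<le> l \<and> l \<le> m \<longrightarrow> (\<forall>i<k. \<kappa> (m - l) i = (\<Sum>q<k. d q * V q i))" for l
      using less.IH[of "m - l"] less.prems by (cases "1 \<le> l \<and> l \<le> m") auto
    then have "\<exists>d. \<forall>l. 1 \<le> l \<and> l \<le> m \<longrightarrow> (\<forall>i<k. \<kappa> (m - l) i = (\<Sum>q<k. d l q * V q i))"
      by (intro choice allI)
    then obtain d where d: "\<And>l i. 1 \<le> l \<Longrightarrow> l \<le> m \<Longrightarrow> i < k \<Longrightarrow> \<kappa> (m - l) i = (\<Sum>q<k. d l q * V q i)"
      by blast
    let ?e = "\<lambda>q. (if q = m then 1 else 0) + (\<Sum>l\<in>{1..m}. \<gamma> l * d l q)"
    have "\<kappa> m i = (\<Sum>q<k. ?e q * V q i)" if "i < k" for i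
    proof -
      have "\<kappa> m i = V m i + (\<Sum>l\<in>{1..m}. \<gamma> l * \<kappa> (m - l) i)" by (simp add: V_def)
      also have "V m i = (\<Sum>q<k. (if q = m then 1 else 0) * V q i)"
        using less.prems by (subst sum.remove[of _ m]) (auto intro!: sum.neutral)
      also have "(\<Sum>l\<in>{1..m}. \<gamma> l * \<kappa> (m - l) i) = (\<Sum>l\<in>{1..m}. \<Sum>q<k. \<gamma> l * d l q * V q i)"
        using d that by (intro sum.cong) (auto simp: sum_distrib_left mult.assoc)
      also have "\<dots> = (\<Sum>q<k. \<Sum>l\<in>{1..m}. \<gamma> l * d l q * V q i)" by (rule sum.swap)
      finally show ?thesis
        by (simp add: distrib_right sum.distrib sum_distrib_right)
    qed
    then show ?case by (intro exI[of _ ?e]) simp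
  qed
  have span: "\<exists>d. \<forall>i<k. w i = (\<Sum>l<k. d l * V l i)" for w
  proof -
    obtain a where a: "\<And>i. i < k \<Longrightarrow> w i = (\<Sum>m<k. a m * \<kappa> m i)"
      using cyc unfolding cyclic_vec_def \<kappa>_def by meson
    obtain d where d: "\<And>m i. m < k \<Longrightarrow> i < k \<Longrightarrow> \<kappa> m i = (\<Sum>l<k. d m l * V l i)"
      using \<kappa>V by metis
    have "w i = (\<Sum>l<k. (\<Sum>m<k. a m * d m l) * V l i)" if "i < k" for i
    proof -
      have "w i = (\<Sum>m<k. \<Sum>l<k. a m * d m l * V l i)"
        using a[OF that] d that by (simp add: sum_distrib_left mult.assoc)
      also have "\<dots> = (\<Sum>l<k. \<Sum>m<k. a m * d m l * V l i)" by (rule sum.swap)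
      finally show ?thesis by (simp add: sum_distrib_right)
    qed
    then show ?thesis by (intro exI[of _ "\<lambda>l. \<Sum>m<k. a m * d m l"]) simp
  qed
  show ?thesis
  proof (rule that[OF V0 _ span])
    fix j i assume "j < k" "i < k"
    then show "mvec k A (V j) i = \<gamma> (Suc j) * c i + (if Suc j < k then V (Suc j) i else 0)"
      using Vk[of i] by (cases "Suc j < k") (auto simp: VSuc not_less dest!: le_antisym[of k "Suc j"])
  qed
qed

text \<open>Conjugation by [1] \<oplus> V, with the basis of \<open>companion_basis\<close> as
  columns, brings \<open>hatm W\<close> to companion form, and it sends the first column to a unit
  vector because \<open>V 0\<close> is that column. The result is \<open>canon n x y\<close> for
  suitable \<open>x\<close> and \<open>y\<close>.\<close>

lemma cyclic_normal_form:
  assumes n: "2 \<le> n" and W: "W \<in> mats n" and cyc: "cyclic_vec (n - 1) (hatm W) (firstcol n W)"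
  obtains M M' where "block_inverses n M M'" "W = conj_by n M M' (canon n (fst (pin n W)) (snd (pin n W)))"
proof -
  define k where "k = n - 1"
  have nk: "n = Suc k" "0 < k" using n by (auto simp: k_def)
  obtain V \<gamma> where V0: "V 0 = firstcol n W"
    and VSuc: "\<And>j i. j < k \<Longrightarrow> i < k \<Longrightarrow>
      mvec k (hatm W) (V j) i = \<gamma> (Suc j) * firstcol n W i + (if Suc j < k then V (Suc j) i else 0)"
    and span: "\<And>w. \<exists>d. \<forall>i<k. w i = (\<Sum>l<k. d l * V l i)"
    using companion_basis[OF cyc[folded k_def]] by blast
  define M :: cmat where "M = (\<lambda>i j. if i = 0 \<or> j = 0 then idm n i j
      else if i < n \<and> j < n then V (j - 1) (i - 1) else 0)"
  \<comment> \<open>Expanding the unit vectors in the spanning family produces a right inverse of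
    the basis matrix, which is then two-sided.\<close>
  have "\<exists>d. \<forall>i<k. idm k i j = (\<Sum>l<k. d l * V l i)" for j by (rule span)
  then obtain d where d: "\<And>i j. i < k \<Longrightarrow> idm k i j = (\<Sum>l<k. d j l * V l i)" by metis
  define M' :: cmat where "M' = (\<lambda>i j. if i = 0 \<or> j = 0 then idm n i j
      else if i < n \<and> j < n then d (j - 1) (i - 1) else 0)"
  have mats: "M \<in> mats n" "M' \<in> mats n" by (auto simp: M_def M'_def mats_def idm_def)
  have "mmult n M M' = idm n"
  proof (rule mats_eqI[OF mmult_in_mats[OF mats] idm_in_mats])
    fix i j assume ij: "i < n" "j < n"
    have split: "mmult n M M' i j = M i 0 * M' 0 j + (\<Sum>l<k. M i (Suc l) * M' (Suc l) j)"
      by (simp add: mmult_def nk sum.lessThan_Suc_shift del: sum.lessThan_Suc)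
    show "mmult n M M' i j = idm n i j"
    proof (cases i)
      case 0
      then show ?thesis unfolding split using nk by (auto simp: M_def M'_def idm_def)
    next
      case (Suc i')
      show ?thesis
      proof (cases j)
        case 0
        then show ?thesis unfolding split using nk Suc by (auto simp: M_def M'_def idm_def)
      next
        case (Suc j')
        have "(\<Sum>l<k. M i (Suc l) * M' (Suc l) j) = (\<Sum>l<k. d j' l * V l i')"
          using ij nk Suc \<open>i = Suc i'\<close> by (intro sum.cong) (auto simp: M_def M'_def)
        also have "\<dots> = idm k i' j'" using d[of i' j'] ij nk \<open>i = Suc i'\<close> by simp
        finally show ?thesis
          unfolding split using nk Suc \<open>i = Suc i'\<close> by (auto simp: M_def M'_def idm_def)
      qed
    qed
  qed
  then have adm: "block_inverses n M M'"
    using mats nk by (intro block_inversesI) (auto simp: block_def M_def idm_def)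
  \<comment> \<open>These solve the formulas of \<open>canon\<close> for prescribed rows: row 1 is
    to be \<gamma>, and row 0 is to be \<open>r\<close>, the top row of \<open>W M\<close>.\<close>
  define y :: cvec where "y j = (if 1 \<le> j \<and> j \<le> k then - ((-1) ^ j * \<gamma> j) else 0)" for j
  define r :: cvec where "r j = (\<Sum>l<k. W 0 (Suc l) * V (j - 1) l)" for j
  define x :: cvec where "x j = (if j = 1 then W 0 0 else if 1 < j \<and> j \<le> n
      then (-1) ^ (j - 1) * r (j - 1) + W 0 0 * y (j - 1) else 0)" for j
  let ?B = "canon n x y"
  have B0: "?B 0 j = r j" "?B 1 j = \<gamma> j" if "1 \<le> j" "j < n" for j
  proof -
    have sgn: "(-1) ^ j * ((-1) ^ j * a) = (a::complex)" for a
      by (simp flip: mult.assoc power_add)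
    show "?B 0 j = r j" "?B 1 j = \<gamma> j"
      using that nk sgn[of "r j"] sgn[of "\<gamma> j"] by (auto simp: canon_def x_def y_def)
  qed
  have WM: "mmult n W M = mmult n M ?B"
  proof (rule mats_eqI[OF mmult_in_mats[OF W mats(1)] mmult_in_mats[OF mats(1) canon_in_mats]])
    fix i j assume ij: "i < n" "j < n"
    have L: "mmult n W M i j = W i 0 * M 0 j + (\<Sum>l<k. W i (Suc l) * M (Suc l) j)"
      by (simp add: mmult_def nk sum.lessThan_Suc_shift del: sum.lessThan_Suc)
    have "mmult n M ?B i j = (\<Sum>l\<in>{0, 1, Suc j} \<inter> {..<n}. M i l * ?B l j)"
      unfolding mmult_def by (rule sum.mono_neutral_right) (auto simp: canon_def)
    \<comment> \<open>For \<open>j = 0\<close> the row \<open>Suc j\<close> is row 1 itself; the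
      guard \<open>1 \<le> j\<close> keeps it from being counted twice.\<close>
    also have "\<dots> = M i 0 * ?B 0 j + M i 1 * ?B 1 j + (if 1 \<le> j \<and> Suc j < n then M i (Suc j) * ?B (Suc j) j else 0)"
    proof -
      have "{0, 1, Suc j} \<inter> {..<n} = (if 1 \<le> j \<and> Suc j < n then {0, 1, Suc j} else {0, 1})"
        using n by auto
      then show ?thesis by auto
    qed
    finally have R: "mmult n M ?B i j =
        M i 0 * ?B 0 j + M i 1 * ?B 1 j + (if 1 \<le> j \<and> Suc j < n then M i (Suc j) * ?B (Suc j) j else 0)" .
    show "mmult n W M i j = mmult n M ?B i j"
    proof (cases j)
      case 0
      have B: "?B 0 0 = W 0 0" "?B 1 0 = 1" using n by (auto simp: canon_def x_def)
      have "mmult n W M i j = W i 0" unfolding L using 0 nk by (auto simp: M_def idm_def)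
      also have "\<dots> = mmult n M ?B i j"
        unfolding R using 0 n ij
        by (cases i) (auto simp: M_def idm_def B B[simplified] V0 firstcol_def)
      finally show ?thesis .
    next
      case (Suc j')
      have j: "1 \<le> j" "j < n" using ij Suc by auto
      have sub: "?B (Suc j) j = 1" if "Suc j < n" using that j by (auto simp: canon_def)
      have L': "mmult n W M i j = (\<Sum>l<k. W i (Suc l) * V j' l)"
        unfolding L using ij nk Suc by (auto simp: M_def idm_def intro!: sum.cong)
      show ?thesis
      proof (cases i)
        case 0
        have "mmult n M ?B i j = r j"
          unfolding R B0[OF j] using 0 j nk by (auto simp: M_def idm_def)
        then show ?thesis unfolding L' using 0 Suc by (simp add: r_def)
      next
        case (Suc i')
        have "mmult n M ?B i j = V 0 i' * \<gamma> j + (if Suc j < n then V j i' else 0)"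
          unfolding R B0[OF j] using Suc j nk ij sub by (auto simp: M_def idm_def)
        moreover have "mmult n W M i j = mvec k (hatm W) (V j') i'"
          unfolding L' by (simp add: mvec_def hatm_def Suc)
        moreover have "\<dots> = \<gamma> (Suc j') * firstcol n W i' + (if Suc j' < k then V (Suc j') i' else 0)"
          using ij nk Suc \<open>j = Suc j'\<close> by (intro VSuc) auto
        ultimately show ?thesis using V0 \<open>j = Suc j'\<close> nk by (simp add: mult.commute)
      qed
    qed
  qed
  have "W = mmult n W (mmult n M M')"
    using adm W by (simp add: block_inverses_def mmult_idm_right)
  then have W_eq: "W = conj_by n M M' ?B"
    by (simp add: conj_by_def flip: mmult_assoc WM)
  \<comment> \<open>Invariance under conjugation identifies the pair read off from the basis with
    \<open>pin n W\<close>, without comparing \<gamma> to minors.\<close>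
  moreover have "pin n W = (x, y)"
  proof -
    have "pin n W = pin n ?B"
      using pin_conj_by[OF n adm, of ?B] W_eq by simp
    also have "\<dots> = (x, y)"
      using n nk by (intro pin_canon) (auto simp: x_def y_def)
    finally show ?thesis .
  qed
  ultimately show ?thesis using that[OF adm] by simp
qed

subsection \<open>Holomorphic interpolation in the block group\<close>

text \<open>One factor of the interpolation: it has the prescribed value at the node \<zeta> and
  does not disturb the nodes in \<open>Z\<close>, so a product of such factors serves all
  nodes.\<close>

definition block_interpolable :: "nat \<Rightarrow> complex set \<Rightarrow> complex \<Rightarrow> cmat \<Rightarrow> cmat \<Rightarrow> bool" where
  "block_interpolable n Z \<zeta> M M' \<longleftrightarrow> (\<exists>F F'. (\<forall>z. block_inverses n (F z) (F' z)) \<and>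
     (\<forall>i j. (\<lambda>z. F z i j) holomorphic_on UNIV \<and> (\<lambda>z. F' z i j) holomorphic_on UNIV) \<and>
     F \<zeta> = M \<and> F' \<zeta> = M' \<and> (\<forall>\<xi>\<in>Z. F \<xi> = idm n))"

lemma block_inverses_idm_imp: "block_inverses n (idm n) M' \<Longrightarrow> M' = idm n"
  by (metis block_inverses_def mmult_idm_left)

lemma block_interpolable_sym:
  assumes "block_interpolable n Z \<zeta> M M'"
  shows "block_interpolable n Z \<zeta> M' M"
proof -
  obtain F F' where F: "\<And>z. block_inverses n (F z) (F' z)"
    "\<And>i j. (\<lambda>z. F z i j) holomorphic_on UNIV" "\<And>i j. (\<lambda>z. F' z i j) holomorphic_on UNIV"
    "F \<zeta> = M" "F' \<zeta> = M'" "\<And>\<xi>. \<xi> \<in> Z \<Longrightarrow> F \<xi> = idm n"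
    using assms unfolding block_interpolable_def by blast
  have "F' \<xi> = idm n" if "\<xi> \<in> Z" for \<xi>
    using block_inverses_idm_imp[of n "F' \<xi>"] F(1)[of \<xi>] F(6)[OF that] by simp
  then show ?thesis
    unfolding block_interpolable_def using F by (intro exI[of _ F'] exI[of _ F]) (auto intro: block_inverses_sym)
qed

lemma holomorphic_mmult:
  assumes "\<And>i j. (\<lambda>z. F z i j) holomorphic_on S" "\<And>i j. (\<lambda>z. G z i j) holomorphic_on S"
  shows "(\<lambda>z. mmult n (F z) (G z) i j) holomorphic_on S"
  unfolding mmult_def by (intro holomorphic_intros assms)

text \<open>Together with \<open>block_interpolable_sym\<close> this lets interpolability pass to
  products and inverses, so explicit entire families are required for generators only.\<close>

lemma block_interpolable_mmult:
  assumes "block_interpolable n Z \<zeta> A A'" "block_interpolable n Z \<zeta> B B'"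
  shows "block_interpolable n Z \<zeta> (mmult n A B) (mmult n B' A')"
proof -
  obtain F F' where F: "\<And>z. block_inverses n (F z) (F' z)"
    "\<And>i j. (\<lambda>z. F z i j) holomorphic_on UNIV" "\<And>i j. (\<lambda>z. F' z i j) holomorphic_on UNIV"
    "F \<zeta> = A" "F' \<zeta> = A'" "\<And>\<xi>. \<xi> \<in> Z \<Longrightarrow> F \<xi> = idm n"
    using assms(1) unfolding block_interpolable_def by blast
  obtain G G' where G: "\<And>z. block_inverses n (G z) (G' z)"
    "\<And>i j. (\<lambda>z. G z i j) holomorphic_on UNIV" "\<And>i j. (\<lambda>z. G' z i j) holomorphic_on UNIV"
    "G \<zeta> = B" "G' \<zeta> = B'" "\<And>\<xi>. \<xi> \<in> Z \<Longrightarrow> G \<xi> = idm n"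
    using assms(2) unfolding block_interpolable_def by blast
  show ?thesis
    unfolding block_interpolable_def
    by (intro exI[of _ "\<lambda>z. mmult n (F z) (G z)"] exI[of _ "\<lambda>z. mmult n (G' z) (F' z)"])
      (use F G in \<open>auto intro: block_inverses_mmult holomorphic_mmult simp: mmult_idm_left idm_in_mats\<close>)
qed

section \<open>Rank one updates as generators of the block group\<close>

definition rank_one_update :: "nat \<Rightarrow> complex \<Rightarrow> cvec \<Rightarrow> cvec \<Rightarrow> cmat" where
  "rank_one_update n t u v = (\<lambda>i j. idm n i j + t * u i * v j)"

text \<open>For fixed \<open>u\<close> and \<open>v\<close> these matrices multiply through their
  scalar parameters alone, so inverting one means solving a scalar equation.\<close>

lemma mmult_rank_one_update:
  assumes "\<And>i. n \<le> i \<Longrightarrow> u i = 0" "\<And>j. n \<le> j \<Longrightarrow> v j = 0"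
  shows "mmult n (rank_one_update n t u v) (rank_one_update n s u v) = rank_one_update n (t + s + t * s * (\<Sum>k<n. v k * u k)) u v"
proof (intro ext)
  fix i j
  have "mmult n (rank_one_update n t u v) (rank_one_update n s u v) i j = (\<Sum>k<n. idm n i k * idm n k j)
      + (\<Sum>k<n. idm n i k * u k) * s * v j + t * u i * (\<Sum>k<n. v k * idm n k j)
      + t * s * u i * v j * (\<Sum>k<n. v k * u k)"
    unfolding mmult_def rank_one_update_def
    by (simp add: sum_distrib_left sum_distrib_right sum.distrib[symmetric] algebra_simps)
  then show "mmult n (rank_one_update n t u v) (rank_one_update n s u v) i j = rank_one_update n (t + s + t * s * (\<Sum>k<n. v k * u k)) u v i j"
    unfolding sum_idm_left sum_idm_right using assms
    by (auto simp: rank_one_update_def idm_def algebra_simps)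
qed

lemma block_inverses_rank_one_update:
  assumes "\<And>i. i = 0 \<or> n \<le> i \<Longrightarrow> u i = 0" "\<And>j. j = 0 \<or> n \<le> j \<Longrightarrow> v j = 0"
    and "t + s + t * s * (\<Sum>k<n. v k * u k) = 0"
  shows "block_inverses n (rank_one_update n t u v) (rank_one_update n s u v)"
proof -
  have "s + t + s * t * (\<Sum>k<n. v k * u k) = 0" using assms(3) by (simp add: algebra_simps)
  moreover have "rank_one_update n 0 u v = idm n" by (simp add: rank_one_update_def)
  ultimately show ?thesis
    using assms mmult_rank_one_update[of n u v t s] mmult_rank_one_update[of n u v s t]
    by (auto simp: block_inverses_def block_def mats_def rank_one_update_def idm_def)
qed

text \<open>The determinant of \<open>rank_one_update n t u v\<close> is \<open>1 + t \<beta>\<close> with \<open>\<beta> = v \<bullet> u\<close>; it is kept away from \<open>0\<close>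
  by choosing \<open>t\<close> such that \<open>1 + t \<beta>\<close> is an exponential.\<close>

lemma block_interpolable_rank_one_update:
  assumes u: "\<And>i. i = 0 \<or> n \<le> i \<Longrightarrow> u i = 0" and v: "\<And>j. j = 0 \<or> n \<le> j \<Longrightarrow> v j = 0"
    and nz: "1 + (\<Sum>k<n. v k * u k) \<noteq> 0" and Z: "finite Z" "\<zeta> \<notin> Z"
  shows "\<exists>R'. block_interpolable n Z \<zeta> (rank_one_update n 1 u v) R'"
proof -
  define \<beta> where "\<beta> = (\<Sum>k<n. v k * u k)"
  \<comment> \<open>The Lagrange polynomial of the node \<zeta>: 1 there and 0 on
    \<open>Z\<close>.\<close>
  define L where "L z = (\<Prod>\<xi>\<in>Z. (z - \<xi>) / (\<zeta> - \<xi>))" for z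
  have L_holo: "L holomorphic_on UNIV"
    unfolding L_def using Z by (intro holomorphic_intros) auto
  have L1: "L \<zeta> = 1" unfolding L_def using Z by (intro prod.neutral) auto
  have L0: "L \<xi> = 0" if "\<xi> \<in> Z" for \<xi> unfolding L_def using Z that by (intro prod_zero) auto
  \<comment> \<open>For \<beta> \<noteq> 0 this makes 1 + \<beta> \<phi> the power of 1 + \<beta>
    with exponent L, and \<psi> belongs to the exponent -L. For \<beta> = 0 the determinant is
    constantly 1 and L itself, the limit of the formula, serves.\<close>
  define \<phi> where "\<phi> = (\<lambda>z. if \<beta> = 0 then L z else (exp (L z * Ln (1 + \<beta>)) - 1) / \<beta>)"
  define \<psi> where "\<psi> = (\<lambda>z. if \<beta> = 0 then - L z else (exp (- (L z * Ln (1 + \<beta>))) - 1) / \<beta>)"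
  have holo: "\<phi> holomorphic_on UNIV" "\<psi> holomorphic_on UNIV"
    unfolding \<phi>_def \<psi>_def by (cases "\<beta> = 0"; simp; intro holomorphic_intros L_holo; simp)+
  have inv: "\<phi> z + \<psi> z + \<phi> z * \<psi> z * \<beta> = 0" for z
  proof (cases "\<beta> = 0")
    case False
    define e where "e = exp (L z * Ln (1 + \<beta>))"
    have "e \<noteq> 0" by (simp add: e_def)
    have eq: "\<phi> z = (e - 1) / \<beta>" "\<psi> z = (1 / e - 1) / \<beta>"
      using False by (simp_all add: \<phi>_def \<psi>_def e_def exp_minus inverse_eq_divide)
    show ?thesis unfolding eq using False \<open>e \<noteq> 0\<close> by (simp add: field_simps)
  qed (simp add: \<phi>_def \<psi>_def)
  have "\<phi> \<zeta> = 1" using nz by (simp add: \<phi>_def L1 \<beta>_def[symmetric])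
  moreover have "\<phi> \<xi> = 0" if "\<xi> \<in> Z" for \<xi> by (simp add: \<phi>_def L0[OF that])
  moreover have "rank_one_update n 0 u v = idm n" by (simp add: rank_one_update_def)
  moreover have "block_inverses n (rank_one_update n (\<phi> z) u v) (rank_one_update n (\<psi> z) u v)" for z
    using u v inv[of z] by (intro block_inverses_rank_one_update) (auto simp: \<beta>_def)
  moreover have "(\<lambda>z. rank_one_update n (\<phi> z) u v i j) holomorphic_on UNIV" "(\<lambda>z. rank_one_update n (\<psi> z) u v i j) holomorphic_on UNIV" for i j
    unfolding rank_one_update_def by (intro holomorphic_intros holo)+
  ultimately show ?thesis
    unfolding block_interpolable_def
    by (intro exI[of _ "rank_one_update n (\<psi> \<zeta>) u v"] exI[of _ "\<lambda>z. rank_one_update n (\<phi> z) u v"] exI[of _ "\<lambda>z. rank_one_update n (\<psi> z) u v"]) auto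
qed

lemma block_interpolableD: "block_interpolable n Z \<zeta> M M' \<Longrightarrow> block_inverses n M M'"
  unfolding block_interpolable_def by blast

text \<open>A rank one perturbation on the left turns column \<open>m\<close> into a unit vector while fixing the
  columns before it.\<close>

lemma block_interpolable_if_leading_columns:
  assumes "block_inverses n M M'" "\<And>i j. j < m \<Longrightarrow> M i j = idm n i j" "1 \<le> m" "m \<le> n"
    and Z: "finite Z" "\<zeta> \<notin> Z"
  shows "block_interpolable n Z \<zeta> M M'"
  using assms(4,1-3)
proof (induction m arbitrary: M M' rule: inc_induct)
  case base
  have "M = idm n"
    using base by (intro mats_eqI[of _ n]) (auto simp: block_inverses_def idm_in_mats)
  moreover from this have "M' = idm n" using base block_inverses_idm_imp by blast
  ultimately show ?case
    unfolding block_interpolable_def using block_inverses_idm by (intro exI[of _ "\<lambda>_. idm n"]) auto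
next
  case (step m)
  note adm = step.prems(1) and cols = step.prems(2)
  have Mm: "M \<in> mats n" "M' \<in> mats n" and M'M: "mmult n M' M = idm n"
    using adm by (auto simp: block_inverses_def)
  \<comment> \<open>Otherwise column \<open>m\<close> of \<open>M\<close> would be supported above
    row \<open>m\<close>. As the earlier columns are unit vectors, row \<open>m\<close> of
    \<open>M'\<close> vanishes before column \<open>m\<close>, and the diagonal entry
    \<open>m\<close> of \<open>M' M\<close> would be 0.\<close>
  have "\<exists>l. m \<le> l \<and> l < n \<and> M l m \<noteq> 0"
  proof (rule ccontr)
    assume "\<not> ?thesis"
    then have z: "M l m = 0" if "m \<le> l" "l < n" for l using that by blast
    have "M' m j = 0" if "j < m" for j
    proof -
      have "mmult n M' M m j = (if j < n then M' m j else 0)"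
        unfolding mmult_def using that by (simp add: cols sum_idm_right)
      then show ?thesis using M'M that step.hyps by (simp add: idm_def)
    qed
    then have "mmult n M' M m m = 0"
      unfolding mmult_def using z by (intro sum.neutral) (metis lessThan_iff mult_eq_0_iff not_le)
    then show False using M'M step.hyps by (simp add: idm_def)
  qed
  then obtain l where l: "m \<le> l" "l < n" "M l m \<noteq> 0" by blast
  \<comment> \<open>With \<open>u\<close> = e_m - M e_m, the update sends M e_m to e_m as soon as v
    \<bullet> M e_m = 1, and it fixes the earlier unit columns if \<open>v\<close> vanishes before
    \<open>m\<close>. Its determinant is then 1 + v \<bullet> u = v_m, so \<open>v m\<close> must
    not be 0; when \<open>M m m\<close> is 0, a second entry at \<open>l\<close> supplies the
    normalization.\<close>
  define v :: cvec where "v = (if M m m \<noteq> 0 then (\<lambda>i. if i = m then 1 / M m m else 0)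
      else (\<lambda>i. if i = m then 1 else if i = l then 1 / M l m else 0))"
  define u :: cvec where "u i = idm n i m - M i m" for i
  have v0: "v i = 0" if "i < m \<or> n \<le> i" for i
    using that l step.hyps by (auto simp: v_def)
  have vm: "v m \<noteq> 0" by (simp add: v_def)
  have vs: "(\<Sum>k<n. v k * M k m) = 1"
  proof (cases "M m m = 0")
    case False
    then have "(\<Sum>k<n. v k * M k m) = (\<Sum>k<n. if k = m then 1 else 0)"
      by (intro sum.cong) (auto simp: v_def)
    then show ?thesis using step.hyps by simp
  next
    case True
    then have "(\<Sum>k<n. v k * M k m) = (\<Sum>k<n. if k = l then 1 else 0)"
      using l by (intro sum.cong) (auto simp: v_def)
    then show ?thesis using l by simp
  qed
  have u0: "u i = 0" if "i = 0 \<or> n \<le> i" for i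
    using that adm Mm step.hyps step.prems(3) by (auto simp: u_def block_inverses_def block_def mats_def idm_def)
  have "(\<Sum>k<n. v k * u k) = (\<Sum>k<n. v k * idm n k m) - (\<Sum>k<n. v k * M k m)"
    by (simp add: u_def algebra_simps sum_subtractf)
  also have "\<dots> = v m - 1" using vs step.hyps by (simp add: sum_idm_right)
  finally have "1 + (\<Sum>k<n. v k * u k) \<noteq> 0" using vm by simp
  moreover have "v j = 0" if "j = 0 \<or> n \<le> j" for j
    using that v0[of j] step.prems(3) by auto
  ultimately obtain R' where R: "block_interpolable n Z \<zeta> (rank_one_update n 1 u v) R'"
    using block_interpolable_rank_one_update[of n u v Z \<zeta>] u0 Z by blast
  let ?R = "rank_one_update n 1 u v"
  have RM: "mmult n ?R M i j = (if i < n then M i j else 0) + u i * (\<Sum>k<n. v k * M k j)" for i j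
    by (simp add: mmult_def rank_one_update_def distrib_right sum.distrib sum_idm_left sum_distrib_left mult.assoc)
  have "block_interpolable n Z \<zeta> (mmult n ?R M) (mmult n M' R')"
  proof (rule step.IH)
    show "block_inverses n (mmult n ?R M) (mmult n M' R')"
      using block_interpolableD[OF R] adm by (rule block_inverses_mmult)
    fix i j assume "j < Suc m"
    then consider "j < m" | "j = m" by linarith
    then show "mmult n ?R M i j = idm n i j"
    proof cases
      case 1
      then have "(\<Sum>k<n. v k * M k j) = 0"
        using step.hyps v0[of j] by (simp add: cols sum_idm_right)
      then show ?thesis unfolding RM using 1 by (simp add: cols idm_def)
    next
      case 2
      have "M i m = 0" if "\<not> i < n" using that Mm by (simp add: mats_def)
      then show ?thesis unfolding RM 2 vs by (simp add: u_def)
    qed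
  qed simp
  then have "block_interpolable n Z \<zeta> (mmult n R' (mmult n ?R M)) (mmult n (mmult n M' R') ?R)"
    by (rule block_interpolable_mmult[OF block_interpolable_sym[OF R]])
  also have "mmult n R' (mmult n ?R M) = M"
    using block_interpolableD[OF R] Mm by (simp add: block_inverses_def mmult_idm_left flip: mmult_assoc)
  also have "mmult n (mmult n M' R') ?R = M'"
    using block_interpolableD[OF R] Mm by (simp add: block_inverses_def mmult_idm_right mmult_assoc)
  finally show ?case .
qed

text \<open>Column 0 of a block matrix is already a unit vector, which starts the column reduction
  at 1.\<close>

lemma block_interpolableI:
  assumes "block_inverses n M M'" "1 \<le> n" "finite Z" "\<zeta> \<notin> Z"
  shows "block_interpolable n Z \<zeta> M M'"
  using assms by (intro block_interpolable_if_leading_columns[of n M M' 1]) (auto simp: block_inverses_def block_def)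

lemma block_inverses_interpolation:
  fixes m :: nat
  assumes adm: "\<And>j. j < m \<Longrightarrow> block_inverses n (A j) (A' j)" and inj: "inj_on \<zeta> {..<m}" and n: "1 \<le> n"
  shows "\<exists>F F'. (\<forall>z. block_inverses n (F z) (F' z)) \<and>
     (\<forall>i j. (\<lambda>z. F z i j) holomorphic_on UNIV \<and> (\<lambda>z. F' z i j) holomorphic_on UNIV) \<and>
     (\<forall>j<m. F (\<zeta> j) = A j \<and> F' (\<zeta> j) = A' j)"
proof -
  \<comment> \<open>Strengthened for the induction: nodes not yet treated carry the identity, so
    multiplying by the next factor changes the value at one node only.\<close>
  have "\<exists>F F'. (\<forall>z. block_inverses n (F z) (F' z)) \<and>
     (\<forall>i j. (\<lambda>z. F z i j) holomorphic_on UNIV \<and> (\<lambda>z. F' z i j) holomorphic_on UNIV) \<and>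
     (\<forall>j<m. F (\<zeta> j) = (if j < p then A j else idm n) \<and> F' (\<zeta> j) = (if j < p then A' j else idm n))"
    if "p \<le> m" for p
    using that
  proof (induction p)
    case 0
    then show ?case using block_inverses_idm by (intro exI[of _ "\<lambda>_. idm n"]) auto
  next
    case (Suc p)
    obtain F F' where F0: "(\<forall>z. block_inverses n (F z) (F' z)) \<and>
       (\<forall>i j. (\<lambda>z. F z i j) holomorphic_on UNIV \<and> (\<lambda>z. F' z i j) holomorphic_on UNIV) \<and>
       (\<forall>j<m. F (\<zeta> j) = (if j < p then A j else idm n) \<and> F' (\<zeta> j) = (if j < p then A' j else idm n))"
      using Suc.IH[OF Suc_leD[OF Suc.prems]] by (elim exE)
    then have F: "\<And>z. block_inverses n (F z) (F' z)"
      "\<And>i j. (\<lambda>z. F z i j) holomorphic_on UNIV" "\<And>i j. (\<lambda>z. F' z i j) holomorphic_on UNIV"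
      "\<And>j. j < m \<Longrightarrow> F (\<zeta> j) = (if j < p then A j else idm n)"
      "\<And>j. j < m \<Longrightarrow> F' (\<zeta> j) = (if j < p then A' j else idm n)"
      by blast+
    let ?Z = "\<zeta> ` ({..<m} - {p})"
    have "block_interpolable n ?Z (\<zeta> p) (A p) (A' p)"
    proof (rule block_interpolableI)
      show "\<zeta> p \<notin> ?Z" using Suc.prems inj by (auto simp: inj_on_def)
    qed (use Suc.prems adm n in auto)
    then obtain G G' where G0: "(\<forall>z. block_inverses n (G z) (G' z)) \<and>
       (\<forall>i j. (\<lambda>z. G z i j) holomorphic_on UNIV \<and> (\<lambda>z. G' z i j) holomorphic_on UNIV) \<and>
       G (\<zeta> p) = A p \<and> G' (\<zeta> p) = A' p \<and> (\<forall>\<xi>\<in>?Z. G \<xi> = idm n)"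
      unfolding block_interpolable_def by (elim exE)
    then have G: "\<And>z. block_inverses n (G z) (G' z)"
      "\<And>i j. (\<lambda>z. G z i j) holomorphic_on UNIV" "\<And>i j. (\<lambda>z. G' z i j) holomorphic_on UNIV"
      "G (\<zeta> p) = A p" "G' (\<zeta> p) = A' p" "\<And>\<xi>. \<xi> \<in> ?Z \<Longrightarrow> G \<xi> = idm n"
      by blast+
    have GZ: "G (\<zeta> j) = idm n" "G' (\<zeta> j) = idm n" if "j < m" "j \<noteq> p" for j
    proof -
      show "G (\<zeta> j) = idm n" using that by (intro G(6)) auto
      then show "G' (\<zeta> j) = idm n" using G(1)[of "\<zeta> j"] by (intro block_inverses_idm_imp) simp
    qed
    have mats: "F z \<in> mats n" "F' z \<in> mats n" "G z \<in> mats n" "G' z \<in> mats n" for z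
      using F(1)[of z] G(1)[of z] by (auto simp: block_inverses_def)
    have "mmult n (F (\<zeta> j)) (G (\<zeta> j)) = (if j < Suc p then A j else idm n) \<and>
        mmult n (G' (\<zeta> j)) (F' (\<zeta> j)) = (if j < Suc p then A' j else idm n)" if "j < m" for j
    proof (cases "j = p")
      case True
      then show ?thesis
        using F(4,5)[OF that] G(4,5) mats[of "\<zeta> p"] by (simp add: mmult_idm_left mmult_idm_right)
    next
      case False
      then show ?thesis
        using F(4,5)[OF that] GZ[OF that] mats[of "\<zeta> j"] by (simp add: mmult_idm_left mmult_idm_right)
    qed
    then show ?case
      using F(1-3) G(1-3)
      by (intro exI[of _ "\<lambda>z. mmult n (F z) (G z)"] exI[of _ "\<lambda>z. mmult n (G' z) (F' z)"])
        (auto intro: block_inverses_mmult holomorphic_mmult)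
  qed
  from this[of m] show ?thesis by auto
qed

subsection \<open>Polynomial functions of the entries\<close>

text \<open>A syntactic class, so that continuity, measurability, holomorphy along holomorphic
  families and dependence on the entries inside the square each follow by one induction.\<close>

inductive entry_poly :: "nat \<Rightarrow> (cmat \<Rightarrow> complex) \<Rightarrow> bool" for n where
  const: "entry_poly n (\<lambda>_. c)"
| entry: "i < n \<Longrightarrow> j < n \<Longrightarrow> entry_poly n (\<lambda>A. A i j)"
| add: "entry_poly n f \<Longrightarrow> entry_poly n g \<Longrightarrow> entry_poly n (\<lambda>A. f A + g A)"
| mult: "entry_poly n f \<Longrightarrow> entry_poly n g \<Longrightarrow> entry_poly n (\<lambda>A. f A * g A)"

lemma entry_poly_sum:
  "(\<And>x. x \<in> S \<Longrightarrow> entry_poly n (f x)) \<Longrightarrow> entry_poly n (\<lambda>A. \<Sum>x\<in>S. f x A)"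
  by (induction S rule: infinite_finite_induct) (auto intro: entry_poly.intros)

lemma entry_poly_prod:
  "(\<And>x. x \<in> S \<Longrightarrow> entry_poly n (f x)) \<Longrightarrow> entry_poly n (\<lambda>A. \<Prod>x\<in>S. f x A)"
  by (induction S rule: infinite_finite_induct) (auto intro: entry_poly.intros)

lemma entry_poly_detn:
  assumes "\<And>i j. i < k \<Longrightarrow> j < k \<Longrightarrow> entry_poly n (\<lambda>A. B A i j)"
  shows "entry_poly n (\<lambda>A. detn k (B A))"
  unfolding detn_def
  by (intro entry_poly_sum entry_poly.mult entry_poly.const entry_poly_prod assms)
    (use permutes_in_image in fastforce)+

lemma entry_poly_minor:
  assumes "I \<subseteq> {..<n}"
  shows "entry_poly n (\<lambda>A. minor A I)"
proof -
  have "sorted_list_of_set I ! a < n" if "a < card I" for a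
  proof -
    have "finite I" using assms by (rule finite_subset) simp
    then have "sorted_list_of_set I ! a \<in> I"
      using that nth_mem[of a "sorted_list_of_set I"] by simp
    then show ?thesis using assms by auto
  qed
  then show ?thesis
    unfolding minor_def Let_def by (intro entry_poly_detn entry_poly.entry) auto
qed

lemma entry_poly_Xc: "0 < n \<Longrightarrow> entry_poly n (\<lambda>A. Xc n A j)"
  by (cases "j = 1"; cases "2 \<le> j \<and> j \<le> n") (auto simp: Xc_def intro!: entry_poly_sum entry_poly_minor entry_poly.intros)

lemma entry_poly_Yc: "entry_poly n (\<lambda>A. Yc n A j)"
  by (cases "1 \<le> j \<and> j \<le> n - 1") (auto simp: Yc_def intro!: entry_poly_sum entry_poly_minor entry_poly.intros)

lemma entry_poly_continuous:
  assumes "entry_poly n f"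
  shows "continuous_on S f"
  using assms
proof induction
  case (entry i j)
  have "continuous_on UNIV (\<lambda>A :: cmat. A i)" by (rule continuous_on_product_coordinates)
  then have "continuous_on UNIV (\<lambda>A :: cmat. A i j)" by (rule continuous_on_product_then_coordinatewise)
  then show ?case by (rule continuous_on_subset) simp
qed (auto intro: continuous_intros)

lemma entry_poly_holomorphic:
  assumes "entry_poly n f" "\<And>i j. i < n \<Longrightarrow> j < n \<Longrightarrow> (\<lambda>z. F z i j) holomorphic_on S"
  shows "(\<lambda>z. f (F z)) holomorphic_on S"
  using assms(1) by induction (auto intro: holomorphic_intros assms(2))

lemma entry_poly_holo_mat_fun:
  assumes "entry_poly n f"
  shows "holo_mat_fun n f"
  unfolding holo_mat_fun_def
proof (intro conjI ballI allI impI)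
  show "continuous_on (mats n) f" using assms by (rule entry_poly_continuous)
  fix A :: cmat and i j
  show "(\<lambda>t. f (A(i := (A i)(j := t)))) holomorphic_on UNIV"
  proof (rule entry_poly_holomorphic[OF assms])
    show "(\<lambda>t. (A(i := (A i)(j := t))) i' j') holomorphic_on UNIV" for i' j'
      by (cases "i' = i"; cases "j' = j") auto
  qed
qed

subsection \<open>Zero sets of separately entire functions\<close>

text \<open>Freezing coordinate \<open>i\<close> at \<open>b i\<close> leaves a function of the
  other coordinates that is nonzero at \<open>b\<close>, hence almost everywhere. Over each such
  point the slice in coordinate \<open>i\<close> is entire and not identically 0, so its zeros are
  countable; integrating over the slices gives measure 0.\<close>

lemma separately_entire_zero_set_null:
  fixes f :: "('i \<Rightarrow> complex) \<Rightarrow> complex"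
  assumes "finite I" "f \<in> borel_measurable (Pi\<^sub>M I (\<lambda>_. lborel :: complex measure))"
    and "\<And>x i. x \<in> extensional I \<Longrightarrow> i \<in> I \<Longrightarrow> (\<lambda>t. f (x(i := t))) holomorphic_on UNIV"
    and "b \<in> extensional I" "f b \<noteq> 0"
  shows "AE x in Pi\<^sub>M I (\<lambda>_. lborel :: complex measure). f x \<noteq> 0"
  using assms
proof (induction I arbitrary: f b rule: finite_induct)
  case empty
  then show ?case by (intro AE_I2) (auto simp: space_PiM)
next
  case (insert i I)
  interpret product_sigma_finite "\<lambda>_. lborel :: complex measure"
    by unfold_locales
  let ?M = "\<lambda>I. Pi\<^sub>M I (\<lambda>_. lborel :: complex measure)"
  have [measurable]: "f \<in> borel_measurable (?M (insert i I))" by fact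
  define g where "g x = f (x(i := b i))" for x
  have upd: "x(i := t) \<in> extensional (insert i I)" if "x \<in> extensional I" for x t
    using that by (auto simp: extensional_def)
  have "(\<lambda>x. x(i := b i)) \<in> measurable (?M I) (?M (insert i I))"
    by (rule measurable_fun_upd[where J = I]) auto
  from measurable_compose[OF this insert.prems(1)] have g_meas: "g \<in> borel_measurable (?M I)"
    by (simp add: g_def[abs_def])
  have "AE x in ?M I. g x \<noteq> 0"
  proof (rule insert.IH[OF g_meas])
    fix x :: "'i \<Rightarrow> complex" and j assume x: "x \<in> extensional I" and j: "j \<in> I"
    then have "(x(j := t))(i := b i) = (x(i := b i))(j := t)" for t
      using insert.hyps(2) by (intro fun_upd_twist) auto
    then have eq: "(\<lambda>t. g (x(j := t))) = (\<lambda>t. f ((x(i := b i))(j := t)))"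
      by (simp only: g_def)
    show "(\<lambda>t. g (x(j := t))) holomorphic_on UNIV"
      unfolding eq by (rule insert.prems(2)[OF upd[OF x]]) (use j in simp)
  next
    \<comment> \<open>A point of the smaller product has to be \<open>undefined\<close> at
      \<open>i\<close>; \<open>g\<close> overwrites this by \<open>b i\<close> again.\<close>
    show "b(i := undefined) \<in> extensional I"
      using insert.prems(3) by (auto simp: extensional_def)
    show "g (b(i := undefined)) \<noteq> 0"
      using insert.prems(4) by (simp add: g_def)
  qed
  then have "AE x in ?M I. (\<integral>\<^sup>+ t. indicator {x \<in> space (?M (insert i I)). f x = 0} (x(i := t)) \<partial>lborel) = 0"
    using AE_space
  proof eventually_elim
    case (elim x)
    then have x: "x \<in> extensional I" by (simp add: space_PiM PiE_def)
    have "countable {t \<in> UNIV. f (x(i := t)) = 0}"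
    proof (cases "(\<lambda>t. f (x(i := t))) constant_on UNIV")
      case True
      then have "f (x(i := t)) = g x" for t unfolding constant_on_def g_def by auto
      then show ?thesis using elim(1) by simp
    next
      case False
      have "(\<lambda>t. f (x(i := t))) holomorphic_on UNIV"
        using insert.prems(2)[OF upd[OF x, of undefined] insertI1] by (simp only: fun_upd_upd)
      then show ?thesis
        using False by (intro holomorphic_countable_zeros) auto
    qed
    then have "AE t in lborel. t \<notin> {t. f (x(i := t)) = 0}"
      by (intro AE_not_in countable_imp_null_set_lborel) simp
    then have "(\<integral>\<^sup>+ t. indicator {x \<in> space (?M (insert i I)). f x = 0} (x(i := t)) \<partial>lborel)
        = (\<integral>\<^sup>+ t. 0 \<partial>(lborel :: complex measure))"
      by (intro nn_integral_cong_AE) (auto elim: eventually_mono simp: indicator_def)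
    then show ?case by simp
  qed
  then have "emeasure (?M (insert i I)) {x \<in> space (?M (insert i I)). f x = 0} = 0"
    using insert.hyps
    by (subst nn_integral_indicator[symmetric], measurable)
      (subst product_nn_integral_insert, auto simp: nn_integral_0_iff_AE)
  then show ?case
    by (subst AE_iff_null) (auto simp: null_sets_def)
qed

section \<open>The Krylov determinant and the exceptional set\<close>

definition krylov :: "nat \<Rightarrow> cmat \<Rightarrow> cmat" where
  "krylov n A = (\<lambda>i m. (mvec (n - 1) (hatm A) ^^ m) (firstcol n A) i)"

lemma cyclic_if_detn_krylov:
  assumes "detn (n - 1) (krylov n A) \<noteq> 0"
  shows "cyclic_vec (n - 1) (hatm A) (firstcol n A)"
  unfolding cyclic_vec_def
proof
  fix w :: cvec
  define k where "k = n - 1"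
  let ?K = "Matrix.mat k k (\<lambda>(i, j). krylov n A i j)"
  let ?w = "Matrix.vec k w"
  \<comment> \<open>Cramer's rule: the adjugate yields the coefficients of \<open>w\<close> in the
    Krylov vectors.\<close>
  let ?c = "(1 / Determinant.det ?K) \<cdot>\<^sub>v (adj_mat ?K *\<^sub>v ?w)"
  have K: "?K \<in> carrier_mat k k" by simp
  have d: "Determinant.det ?K \<noteq> 0" using assms by (simp add: detn_eq_det k_def)
  have "?K *\<^sub>v ?c = (1 / Determinant.det ?K) \<cdot>\<^sub>v (?K * adj_mat ?K *\<^sub>v ?w)"
    using adj_mat(1)[OF K]
    by (simp add: mult_mat_vec[OF K] assoc_mult_mat_vec[OF K])
  also have "\<dots> = ?w"
    unfolding adj_mat(2)[OF K] using d by (intro eq_vecI) auto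
  finally have eq: "?K *\<^sub>v ?c = ?w" .
  have "w i = (\<Sum>m<k. ?c $ m * (mvec k (hatm A) ^^ m) (firstcol n A) i)" if "i < k" for i
  proof -
    have "w i = (?K *\<^sub>v ?c) $ i" using eq that by simp
    also have "\<dots> = (\<Sum>m<k. krylov n A i m * ?c $ m)"
      using that adj_mat(1)[OF K] by (simp add: scalar_prod_def lessThan_atLeast0)
    finally show ?thesis by (simp add: krylov_def k_def mult.commute)
  qed
  then show "\<exists>c. \<forall>i<n - 1. w i = (\<Sum>m<n - 1. c m * (mvec (n - 1) (hatm A) ^^ m) (firstcol n A) i)"
    unfolding k_def[symmetric] by (intro exI[of _ "\<lambda>m. ?c $ m"]) simp
qed

lemma entry_poly_krylov:
  "i < n - 1 \<Longrightarrow> entry_poly n (\<lambda>A. krylov n A i m)"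
proof (induction m arbitrary: i)
  case 0
  then show ?case by (auto simp: krylov_def firstcol_def intro: entry_poly.entry)
next
  case (Suc m)
  have "krylov n A i (Suc m) = (\<Sum>l<n - 1. A (Suc i) (Suc l) * krylov n A l m)" for A
    by (simp add: krylov_def mvec_def hatm_def)
  then show ?case
    using Suc by (auto intro!: entry_poly_sum entry_poly.mult entry_poly.entry)
qed

text \<open>The witness that the Krylov determinant is not the zero polynomial: the shift runs
  through the unit vectors in order.\<close>

lemma krylov_shift:
  assumes "2 \<le> n" "i < n - 1" "m < n - 1"
  shows "krylov n (\<lambda>i j. if i = Suc j then 1 else 0) i m = idm (n - 1) i m"
  using assms(2,3)
proof (induction m arbitrary: i)
  case 0
  then show ?case by (simp add: krylov_def firstcol_def idm_def)
next
  case (Suc m)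
  let ?A = "\<lambda>i j. if i = Suc j then 1 else 0 :: complex"
  have "krylov n ?A i (Suc m) = (\<Sum>l<n - 1. ?A (Suc i) (Suc l) * krylov n ?A l m)"
    by (simp add: krylov_def mvec_def hatm_def)
  also have "\<dots> = (\<Sum>l<n - 1. ?A (Suc i) (Suc l) * idm (n - 1) l m)"
    using Suc by (intro sum.cong) auto
  also have "\<dots> = idm (n - 1) i (Suc m)"
    unfolding sum_idm_right using Suc.prems by (auto simp: idm_def)
  finally show ?case .
qed

lemma null_Omega_minus_Omega_t:
  assumes n: "2 \<le> n"
  shows "lebesgue_null_mats n (Omega n - Omega_t n)"
proof -
  let ?I = "{..<n} \<times> {..<n}"
  let ?M = "Pi\<^sub>M ?I (\<lambda>_. lborel :: complex measure)"
  let ?h = "\<lambda>A. detn (n - 1) (krylov n A)"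
  let ?f = "\<lambda>x. ?h (\<lambda>i j. x (i, j))"
  have poly: "entry_poly n ?h"
    by (intro entry_poly_detn entry_poly_krylov)
  have meas: "(\<lambda>x. g (\<lambda>i j. x (i, j))) \<in> borel_measurable ?M" if "entry_poly n g" for g
    using that
  proof induction
    case (entry i j)
    have "(\<lambda>x. x (i, j)) \<in> measurable ?M lborel"
      using entry by (intro measurable_component_singleton) auto
    then show ?case by simp
  qed auto
  \<comment> \<open>Points of the product space are \<open>undefined\<close> outside the index
    square, where matrices are 0; a polynomial in the entries does not see the difference.\<close>
  have cong: "g A = g B" if "entry_poly n g" "\<And>i j. i < n \<Longrightarrow> j < n \<Longrightarrow> A i j = B i j" for g A B
    using that by induction auto
  define S where "S = restrict (\<lambda>(i, j). if i = Suc j then 1 else 0 :: complex) ?I"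
  have "?f S = ?h (\<lambda>i j. if i = Suc j then 1 else 0)"
    by (rule cong[OF poly]) (simp add: S_def)
  also have "\<dots> = detn (n - 1) (idm (n - 1))"
    using n by (intro detn_cong krylov_shift)
  finally have S: "?f S \<noteq> 0" by (simp add: detn_idm)
  have "AE x in ?M. ?f x \<noteq> 0"
  proof (rule separately_entire_zero_set_null[of ?I ?f S])
    show "?f \<in> borel_measurable ?M" by (rule meas[OF poly])
    show "?f S \<noteq> 0" by (rule S)
    show "(\<lambda>t. ?h (\<lambda>i j. (x(p := t)) (i, j))) holomorphic_on UNIV" for x p
    proof (rule entry_poly_holomorphic[OF poly])
      show "(\<lambda>t. (x(p := t)) (i, j)) holomorphic_on UNIV" for i j
        by (cases "p = (i, j)") auto
    qed
    show "S \<in> extensional ?I" unfolding S_def by (rule restrict_extensional)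
  qed simp
  moreover have fm: "?f \<in> borel_measurable ?M" by (rule meas[OF poly])
  ultimately have null: "{x \<in> space ?M. ?f x = 0} \<in> null_sets ?M"
    by (subst (asm) AE_iff_null) (auto simp: borel_measurable_eq)
  have "(\<lambda>A. restrict (\<lambda>(i, j). A i j) ?I) ` (Omega n - Omega_t n) \<subseteq> {x \<in> space ?M. ?f x = 0}"
  proof clarify
    fix A assume A: "A \<in> Omega n" "A \<notin> Omega_t n"
    \<comment> \<open>A cyclic first column would itself witness \<open>non_derogatory\<close> and
      put \<open>A\<close> into \<open>Omega_t\<close>.\<close>
    then have "\<not> cyclic_vec (n - 1) (hatm A) (firstcol n A)"
      by (auto simp: Omega_t_def non_derogatory_def)
    then have "?h A = 0" using cyclic_if_detn_krylov by blast
    moreover have "?f (restrict (\<lambda>(i, j). A i j) ?I) = ?h A"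
      by (rule cong[OF poly]) simp
    ultimately show "restrict (\<lambda>(i, j). A i j) ?I \<in> space ?M \<and> ?f (restrict (\<lambda>(i, j). A i j) ?I) = 0"
      by (auto simp: space_PiM)
  qed
  \<comment> \<open>The exceptional set is only known to lie inside a null set; completeness of the
    measure makes it measurable.\<close>
  then show ?thesis
    unfolding lebesgue_null_mats_def
    using null by (blast intro: null_sets_completion_subset null_sets_completionI)
qed

text \<open>The canonical matrix of \<open>f z\<close> lifts \<open>f\<close>, but at a node it is
  only conjugate to the prescribed matrix. Conjugating by an entire family with the right values at
  the nodes repairs this, and the lift stays over \<open>f\<close> because \<open>pin\<close> is
  invariant.\<close>

lemma holo_lifting:
  assumes n: "2 \<le> n" and inj: "inj_on \<zeta> {..<M}" and \<zeta>: "\<And>j. j < M \<Longrightarrow> \<zeta> j \<in> ball 0 1"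
    and W: "\<And>j. j < (M::nat) \<Longrightarrow> W j \<in> Omega_t n"
    and f: "holo_into_pairs f (G1n n)" "\<And>j. j < M \<Longrightarrow> f (\<zeta> j) = pin n (W j)"
  shows "\<exists>F. holo_into_mats n F (Omega n) \<and> (\<forall>j<M. F (\<zeta> j) = W j)"
proof -
  have "\<exists>A A'. j < M \<longrightarrow> block_inverses n A A' \<and> W j = conj_by n A A' (canon n (fst (pin n (W j))) (snd (pin n (W j))))" for j
  proof (cases "j < M")
    case True
    then have "W j \<in> mats n" "cyclic_vec (n - 1) (hatm (W j)) (firstcol n (W j))"
      using W[of j] by (auto simp: Omega_t_def Omega_def)
    from cyclic_normal_form[OF n this] show ?thesis by blast
  qed simp
  then obtain A A' where A: "\<And>j. j < M \<Longrightarrow> block_inverses n (A j) (A' j)"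
    "\<And>j. j < M \<Longrightarrow> W j = conj_by n (A j) (A' j) (canon n (fst (pin n (W j))) (snd (pin n (W j))))"
    by metis
  have "\<exists>F F'. (\<forall>z. block_inverses n (F z) (F' z)) \<and>
     (\<forall>i j. (\<lambda>z. F z i j) holomorphic_on UNIV \<and> (\<lambda>z. F' z i j) holomorphic_on UNIV) \<and>
     (\<forall>j<M. F (\<zeta> j) = A j \<and> F' (\<zeta> j) = A' j)"
    using A(1) inj n by (intro block_inverses_interpolation) auto
  then obtain T T' where "(\<forall>z. block_inverses n (T z) (T' z)) \<and>
     (\<forall>i j. (\<lambda>z. T z i j) holomorphic_on UNIV \<and> (\<lambda>z. T' z i j) holomorphic_on UNIV) \<and>
     (\<forall>j<M. T (\<zeta> j) = A j \<and> T' (\<zeta> j) = A' j)"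
    by (elim exE)
  then have T: "\<And>z. block_inverses n (T z) (T' z)"
    "\<And>i j. (\<lambda>z. T z i j) holomorphic_on UNIV" "\<And>i j. (\<lambda>z. T' z i j) holomorphic_on UNIV"
    "\<And>j. j < M \<Longrightarrow> T (\<zeta> j) = A j" "\<And>j. j < M \<Longrightarrow> T' (\<zeta> j) = A' j"
    by blast+
  define B where "B z = canon n (fst (f z)) (snd (f z))" for z
  define F where "F z = conj_by n (T z) (T' z) (B z)" for z
  have "F z \<in> Omega n" if "z \<in> ball 0 1" for z
  proof -
    have fz: "f z \<in> G1n n" using f(1) that by (auto simp: holo_into_pairs_def)
    have "pin n (F z) = pin n (B z)"
      unfolding F_def by (rule pin_conj_by[OF n T(1)])
    also have "\<dots> = f z"
      unfolding B_def using fz n by (subst pin_canon) (auto simp: G1n_def)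
    finally show ?thesis
      using fz by (simp add: Omega_iff[OF n] F_def B_def conj_by_in_mats[OF T(1)] canon_in_mats)
  qed
  moreover have "(\<lambda>z. F z i j) holomorphic_on ball 0 1" for i j
  proof -
    have hol: "(\<lambda>z. fst (f z) j) holomorphic_on ball 0 1" "(\<lambda>z. snd (f z) j) holomorphic_on ball 0 1" for j
      using f(1) by (auto simp: holo_into_pairs_def)
    have "(\<lambda>z. B z i j) holomorphic_on ball 0 1" for i j
    proof -
      have "(\<lambda>z. (-1) ^ j * (fst (f z) (Suc j) - fst (f z) 1 * snd (f z) j)) holomorphic_on ball 0 1"
        "(\<lambda>z. - ((-1) ^ j * snd (f z) j)) holomorphic_on ball 0 1"
        by (intro holomorphic_intros hol)+
      then show ?thesis
        using hol(1)[of 1] unfolding B_def canon_def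
        by (cases "i < n \<and> j < n"; cases "i = 0"; cases "i = 1"; cases "j = 0"; cases "i = Suc j") auto
    qed
    moreover have "(\<lambda>z. T z i j) holomorphic_on ball 0 1" "(\<lambda>z. T' z i j) holomorphic_on ball 0 1" for i j
      using T(2,3)[of i j] by (auto intro: holomorphic_on_subset)
    ultimately show ?thesis
      unfolding F_def conj_by_def by (intro holomorphic_mmult)
  qed
  moreover have "F (\<zeta> j) = W j" if "j < M" for j
    using A(2)[OF that] by (simp add: F_def B_def T(4,5) f(2) that)
  ultimately show ?thesis
    by (intro exI[of _ F]) (auto simp: holo_into_mats_def)
qed

theorem theorem1:
  fixes n :: nat
  assumes "2 \<le> n"
  shows "lebesgue_null_mats n (Omega n - Omega_t n)
    \<and> (\<forall>j. holo_mat_fun n (\<lambda>A. fst (pin n A) j) \<and> holo_mat_fun n (\<lambda>A. snd (pin n A) j))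
    \<and> pin n ` Omega n = G1n n
    \<and> (\<forall>(M::nat) (\<zeta>::nat \<Rightarrow> complex) (W::nat \<Rightarrow> cmat).
         inj_on \<zeta> {..<M} \<and> (\<forall>j<M. \<zeta> j \<in> ball 0 1) \<and> (\<forall>j<M. W j \<in> Omega_t n) \<longrightarrow>
         ((\<exists>F. holo_into_mats n F (Omega n) \<and> (\<forall>j<M. F (\<zeta> j) = W j))
          \<longleftrightarrow> (\<exists>f. holo_into_pairs f (G1n n) \<and> (\<forall>j<M. f (\<zeta> j) = pin n (W j)))))"
proof (intro conjI allI impI)
  show "lebesgue_null_mats n (Omega n - Omega_t n)"
    using assms by (rule null_Omega_minus_Omega_t)
  fix j
  have poly: "entry_poly n (\<lambda>A. fst (pin n A) j)" "entry_poly n (\<lambda>A. snd (pin n A) j)" for j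
    using assms by (simp_all add: pin_def entry_poly_Xc entry_poly_Yc)
  show "holo_mat_fun n (\<lambda>A. fst (pin n A) j)" "holo_mat_fun n (\<lambda>A. snd (pin n A) j)"
    by (rule entry_poly_holo_mat_fun[OF poly(1)], rule entry_poly_holo_mat_fun[OF poly(2)])
  show "pin n ` Omega n = G1n n"
    using assms by (rule pin_image_Omega)
  fix M :: nat and \<zeta> :: "nat \<Rightarrow> complex" and W :: "nat \<Rightarrow> cmat"
  assume *: "inj_on \<zeta> {..<M} \<and> (\<forall>j<M. \<zeta> j \<in> ball 0 1) \<and> (\<forall>j<M. W j \<in> Omega_t n)"
  show "(\<exists>F. holo_into_mats n F (Omega n) \<and> (\<forall>j<M. F (\<zeta> j) = W j))
          \<longleftrightarrow> (\<exists>f. holo_into_pairs f (G1n n) \<and> (\<forall>j<M. f (\<zeta> j) = pin n (W j)))"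
  proof
    assume "\<exists>F. holo_into_mats n F (Omega n) \<and> (\<forall>j<M. F (\<zeta> j) = W j)"
    then obtain F where F: "\<And>z. z \<in> ball 0 1 \<Longrightarrow> F z \<in> Omega n"
      "\<And>i j. i < n \<Longrightarrow> j < n \<Longrightarrow> (\<lambda>z. F z i j) holomorphic_on ball 0 1"
      "\<And>j. j < M \<Longrightarrow> F (\<zeta> j) = W j"
      unfolding holo_into_mats_def by blast
    have "holo_into_pairs (\<lambda>z. pin n (F z)) (G1n n)"
      unfolding holo_into_pairs_def
      using F(1) Omega_iff[OF assms] entry_poly_holomorphic[OF poly(1), of F "ball 0 1"]
        entry_poly_holomorphic[OF poly(2), of F "ball 0 1"] F(2) by blast
    with F(3) show "\<exists>f. holo_into_pairs f (G1n n) \<and> (\<forall>j<M. f (\<zeta> j) = pin n (W j))"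
      by (intro exI[of _ "\<lambda>z. pin n (F z)"]) auto
  next
    assume "\<exists>f. holo_into_pairs f (G1n n) \<and> (\<forall>j<M. f (\<zeta> j) = pin n (W j))"
    then show "\<exists>F. holo_into_mats n F (Omega n) \<and> (\<forall>j<M. F (\<zeta> j) = W j)"
      using holo_lifting[OF assms] * by blast
  qed
qed

end
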